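(* Let $n\ge 2$ and let $m_1<\cdots<m_n$ be an arithmetic sequence of positive integers, i.e. $m_i=m_1+(i-1)d$ for all $i\in\{1,\ldots,n\}$ with $d\in\mathbb{Z}^+$, and suppose $\gcd\{m_1,d\}=1$. Let $c\in\mathbb{Z}$ and $\tau\in\{1,\ldots,n-1\}$ be such that $m_1-1=c(n-1)+\tau$. Then the Cohen-Macaulay type of $K[\mathcal{C}]$ is $\tau$.
   Context: $K$ is an infinite field and $R=K[x_1,\ldots,x_{n+1}]$ with its standard grading. For positive integers $m_1<\cdots<m_n$, the associated projective monomial curve $\mathcal{C}\subset\mathbb{P}^n_K$ is parametrically defined by $x_i=u^{m_i}v^{m_n-m_i}$ for $1\le i\le n$ and $x_{n+1}=v^{m_n}$. Its vanishing ideal $I(\mathcal{C})\subset R$ is the kernel of the $K$-algebra homomorphism $R\to K[u,v]$, $x_i\mapsto u^{m_i}v^{m_n-m_i}$ ($1\le i\le n$), $x_{n+1}\mapsto v^{m_n}$, and $K[\mathcal{C}]=R/I(\mathcal{C})$. Under the stated hypotheses $K[\mathcal{C}]$ is Cohen-Macaulay; its Cohen-Macaulay type is the rank $\beta_p$ of the last nonzero free module in a minimal graded free resolution $0\to\bigoplus_{j=1}^{\beta_p}R(-e_{pj})\to\cdots\to R\to K[\mathcal{C}]\to0$. *)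

theory Defs
  imports
    "HOL-Library.Poly_Mapping"
    "Jordan_Normal_Form.Matrix_Kernel"
begin

text \<open>
  Multivariate polynomials are finitely supported maps from exponent vectors to coefficients;
  the multiplication of \<open>poly_mapping\<close> is the convolution product. Variables are
  indexed by \<open>nat\<close>, and the polynomial ring in \<open>x\<^sub>1, \<dots>, x\<^sub>N\<close> is the carrier set \<open>polys N\<close>.
\<close>

type_synonym 'a mpoly = "(nat \<Rightarrow>\<^sub>0 nat) \<Rightarrow>\<^sub>0 'a"

definition var :: "nat \<Rightarrow> 'a::comm_ring_1 mpoly" where
  "var i = Poly_Mapping.single (Poly_Mapping.single i 1) 1"

definition const :: "'a::comm_ring_1 \<Rightarrow> 'a mpoly" where
  "const a = Poly_Mapping.single 0 a"

definition polys :: "nat \<Rightarrow> 'a::comm_ring_1 mpoly set" where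
  "polys N = {f. \<forall>t \<in> Poly_Mapping.keys f. Poly_Mapping.keys t \<subseteq> {1..N}}"

definition mon_degree :: "(nat \<Rightarrow>\<^sub>0 nat) \<Rightarrow> nat" where
  "mon_degree t = (\<Sum>i \<in> Poly_Mapping.keys t. Poly_Mapping.lookup t i)"

text \<open>The zero polynomial is homogeneous of every degree, and only it is of a negative degree.\<close>

definition homogeneous :: "int \<Rightarrow> 'a::comm_ring_1 mpoly \<Rightarrow> bool" where
  "homogeneous d f \<longleftrightarrow> (\<forall>t \<in> Poly_Mapping.keys f. int (mon_degree t) = d)"

text \<open>The homogeneous maximal ideal \<open>(x\<^sub>1, \<dots>, x\<^sub>N)\<close>: polynomials without constant term.\<close>

definition irrelevant_ideal :: "nat \<Rightarrow> 'a::comm_ring_1 mpoly set" where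
  "irrelevant_ideal N = {f \<in> polys N. Poly_Mapping.lookup f 0 = 0}"

text \<open>The algebra homomorphism that sends \<open>x\<^sub>i\<close> to \<open>g i\<close>.\<close>

definition subst :: "(nat \<Rightarrow> 'a::comm_ring_1 mpoly) \<Rightarrow> 'a mpoly \<Rightarrow> 'a mpoly" where
  "subst g f = (\<Sum>t \<in> Poly_Mapping.keys f.
     const (Poly_Mapping.lookup f t) *
     (\<Prod>i \<in> Poly_Mapping.keys t. g i ^ Poly_Mapping.lookup t i))"


subsection \<open>Projective monomial curves\<close>

text \<open>
  \<open>K[u,v]\<close> is \<open>polys 2\<close>, with \<open>u = var 1\<close> and \<open>v = var 2\<close>. The subtraction on \<open>nat\<close>
  is not truncated when \<open>m\<close> is increasing on \<open>{1..n}\<close>.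
\<close>

definition curve_param :: "nat \<Rightarrow> (nat \<Rightarrow> nat) \<Rightarrow> nat \<Rightarrow> 'a::comm_ring_1 mpoly" where
  "curve_param n m i =
     (if i \<le> n then var 1 ^ m i * var 2 ^ (m n - m i) else var 2 ^ m n)"

definition vanishing_ideal :: "nat \<Rightarrow> (nat \<Rightarrow> nat) \<Rightarrow> 'a::comm_ring_1 mpoly set" where
  "vanishing_ideal n m = {f \<in> polys (n + 1). subst (curve_param n m) f = 0}"


subsection \<open>Minimal graded free resolutions\<close>

definition free_module :: "nat \<Rightarrow> nat \<Rightarrow> 'a::comm_ring_1 mpoly vec set" where
  "free_module N b = {w \<in> carrier_vec b. \<forall>j < b. w $ j \<in> polys N}"

text \<open>
  A resolution \<open>\<cdots> \<rightarrow> F\<^sub>2 \<rightarrow> F\<^sub>1 \<rightarrow> F\<^sub>0 = R \<rightarrow> R/I \<rightarrow> 0\<close> over \<open>R = polys N\<close> is given by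
  the twists \<open>e\<close> and the differentials \<open>\<phi>\<close>: the module \<open>F\<^sub>i\<close> is the direct sum of the
  \<open>R(-e\<^sub>i\<^sub>j)\<close> over the entries \<open>e\<^sub>i\<^sub>j\<close> of the list \<open>e i\<close>, so that \<open>F\<^sub>i = 0\<close> iff \<open>e i = []\<close>,
  and \<open>\<phi> i\<close>, for \<open>i \<ge> 1\<close>, is the matrix of \<open>F\<^sub>i \<rightarrow> F\<^sub>i\<^sub>-\<^sub>1\<close>. The generator \<open>j\<close> of \<open>F\<^sub>i\<close> has
  degree \<open>e\<^sub>i\<^sub>j\<close>, so \<open>\<phi> i\<close> preserves degrees iff its entry \<open>(k, j)\<close> is homogeneous
  of degree \<open>e\<^sub>i\<^sub>j - e\<^sub>i\<^sub>-\<^sub>1\<^sub>,\<^sub>k\<close>.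

  Below, \<open>cycles\<close> is the kernel of the map out of \<open>F\<^sub>i\<close>; for \<open>i = 0\<close> this map is the
  projection \<open>R \<rightarrow> R/I\<close>.
\<close>

definition cycles ::
  "nat \<Rightarrow> 'a::comm_ring_1 mpoly set \<Rightarrow> (nat \<Rightarrow> int list) \<Rightarrow> (nat \<Rightarrow> 'a mpoly mat) \<Rightarrow>
   nat \<Rightarrow> 'a mpoly vec set" where
  "cycles N I e \<phi> i =
     (if i = 0 then {w \<in> free_module N 1. w $ 0 \<in> I}
      else mat_kernel (\<phi> i) \<inter> free_module N (length (e i)))"

definition boundaries ::
  "nat \<Rightarrow> (nat \<Rightarrow> int list) \<Rightarrow> (nat \<Rightarrow> 'a::comm_ring_1 mpoly mat) \<Rightarrow>
   nat \<Rightarrow> 'a mpoly vec set" where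
  "boundaries N e \<phi> i = (\<lambda>w. \<phi> (Suc i) *\<^sub>v w) ` free_module N (length (e (Suc i)))"

definition graded_free_resolution ::
  "nat \<Rightarrow> 'a::comm_ring_1 mpoly set \<Rightarrow> (nat \<Rightarrow> int list) \<Rightarrow> (nat \<Rightarrow> 'a mpoly mat) \<Rightarrow> bool" where
  "graded_free_resolution N I e \<phi> \<longleftrightarrow>
     e 0 = [0] \<and>
     (\<forall>i. \<phi> (Suc i) \<in> carrier_mat (length (e i)) (length (e (Suc i)))) \<and>
     (\<forall>i. \<forall>k < length (e i). \<forall>j < length (e (Suc i)).
        \<phi> (Suc i) $$ (k, j) \<in> polys N \<and>
        homogeneous (e (Suc i) ! j - e i ! k) (\<phi> (Suc i) $$ (k, j))) \<and>
     (\<forall>i. cycles N I e \<phi> i = boundaries N e \<phi> i)"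

definition minimal_graded_free_resolution ::
  "nat \<Rightarrow> 'a::comm_ring_1 mpoly set \<Rightarrow> (nat \<Rightarrow> int list) \<Rightarrow> (nat \<Rightarrow> 'a mpoly mat) \<Rightarrow> bool" where
  "minimal_graded_free_resolution N I e \<phi> \<longleftrightarrow>
     graded_free_resolution N I e \<phi> \<and>
     (\<forall>i. \<forall>k < length (e i). \<forall>j < length (e (Suc i)).
        \<phi> (Suc i) $$ (k, j) \<in> irrelevant_ideal N)"

text \<open>
  The rank of the last nonzero free module in a minimal graded free resolution of \<open>R/I\<close>,
  which is the Cohen-Macaulay type of \<open>R/I\<close> when \<open>R/I\<close> is Cohen-Macaulay. By the use of
  \<open>THE\<close>, an equation for this number can be proved only by showing that a finite
  minimal resolution exists and that the rank does not depend on its choice.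
\<close>

definition cohen_macaulay_type :: "nat \<Rightarrow> 'a::comm_ring_1 mpoly set \<Rightarrow> nat" where
  "cohen_macaulay_type N I =
     (THE t. \<exists>e \<phi> p. minimal_graded_free_resolution N I e \<phi> \<and>
        e p \<noteq> [] \<and> (\<forall>i > p. e i = []) \<and> t = length (e p))"

end

(*
  Let M = F_0 / Z have a minimal free resolution F over K[x_1, ..., x_q]. The variable x_q is
  regular on Z, so F_1 <- F_2 <- ... modulo x_q is a minimal resolution of Z / x_q Z over
  K[x_1, ..., x_(q-1)], and multiplication by x_q identifies the socle of M with the socle of
  Z / x_q Z. After q steps nothing is left but the vector space F_q: its dimension is that of the
  socle of M, and F_i = 0 for i > q.

  For the curve, x_(n+1) and x_n form a regular sequence on K[C], so that this applies with
  q = n - 1 to the Artinian reduction A = K[C] / (x_n, x_(n+1)). Since x_i x_j = x_(i-1) x_(j+1)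
  in K[C], the monomials of A are 1 and x_1^(k-1) x_j with k >= 1 and j < n, and such a monomial
  is nonzero iff k <= c + d, or k = c + d + 1 and j >= n - tau. The socle of A is its part of
  degree c + d + 1, which is of dimension tau.

  A minimal resolution exists because the graded submodules of a free module are finitely
  generated, which follows from Dickson's lemma by reduction of leading terms.
*)

theory Submission
  imports Defs "HOL-Library.Function_Algebras"
begin

section \<open>Polynomials\<close>

text \<open>The type is defined by \<open>THE\<close>, so all minimal resolutions must give the same
  rank. They are never compared: the rank is computed for an arbitrary one, and uniqueness is a
  by-product. Quotients are not formed either; socles and bases are expressed modulo a submodule.

  The curve becomes tractable because K[C] is at most one-dimensional in each bidegree (exponent of
  u, degree). A polynomial lies in the ideal iff its coefficients sum to zero over each bidegree,
  and setting variables to zero drops the equations of those bidegrees that contain a monomial with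
  such a variable. The Artinian reduction is thus known once it is known which equations are
  dropped.

  The bound c + d + 1 comes from the weights r m_1 + s d. As m_1 and d are coprime, (r, s) can
  change only by multiples of (-d, m_1). So x_1^(k-1) x_j dies as soon as k - d factors can carry
  the index sum j - 1 + m_1, that is, if j - 1 + m_1 <= (k - d) (n - 1). By m_1 - 1 = c (n - 1) +
  \<tau> this reads j + \<tau> <= (k - c - d) (n - 1).\<close>

abbreviation keys :: "('a \<Rightarrow>\<^sub>0 'b::zero) \<Rightarrow> 'a set" where "keys \<equiv> Poly_Mapping.keys"
abbreviation lookup :: "('a \<Rightarrow>\<^sub>0 'b::zero) \<Rightarrow> 'a \<Rightarrow> 'b" where "lookup \<equiv> Poly_Mapping.lookup"

lemma sum_single_lookup: "(\<Sum>t \<in> keys f. Poly_Mapping.single t (lookup f t)) = f"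
  by (intro poly_mapping_eqI)
    (auto simp: lookup_sum lookup_single when_def in_keys_iff)

lemma times_expand:
  "f * g = (\<Sum>s \<in> keys f. \<Sum>t \<in> keys g. Poly_Mapping.single (s + t) (lookup f s * lookup g t))"
    (is "_ = ?R") for f g :: "'a::monoid_add \<Rightarrow>\<^sub>0 'b::semiring_0"
proof -
  have "f * g = (\<Sum>s \<in> keys f. Poly_Mapping.single s (lookup f s)) *
      (\<Sum>t \<in> keys g. Poly_Mapping.single t (lookup g t))"
    by (simp add: sum_single_lookup)
  also have "\<dots> = ?R"
    by (simp add: sum_product mult_single)
  finally show ?thesis .
qed

lemma lookup_monomial_times:
  "lookup (Poly_Mapping.single s c * f) (s + t) = c * lookup f t"
  for f :: "'a::cancel_comm_monoid_add \<Rightarrow>\<^sub>0 'b::semiring_0"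
  by (auto simp: times_expand lookup_sum lookup_single when_def in_keys_iff)

lemma keys_plus_nat: "keys (s + t) = keys s \<union> keys t" for s t :: "'a \<Rightarrow>\<^sub>0 nat"
  by (auto simp: in_keys_iff lookup_add)

text \<open>One projection serves three purposes: \<open>kill\<close> keeps the monomials that avoid
  some variables, \<open>hcomp\<close> those of one degree, \<open>fibre_sum\<close> those of one
  bidegree.\<close>

definition restr :: "('a \<Rightarrow> bool) \<Rightarrow> ('a \<Rightarrow>\<^sub>0 'b) \<Rightarrow> ('a \<Rightarrow>\<^sub>0 'b::zero)" where
  "restr P f = Poly_Mapping.mapp (\<lambda>t c. if P t then c else 0) f"

lemma lookup_restr: "lookup (restr P f) t = (if P t then lookup f t else 0)"
  by (auto simp: restr_def lookup_mapp when_def in_keys_iff)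

lemma keys_restr: "keys (restr P f) = {t \<in> keys f. P t}"
  by (auto simp: in_keys_iff lookup_restr split: if_splits)

lemma restr_zero [simp]: "restr P 0 = 0"
  by (intro poly_mapping_eqI) (simp add: lookup_restr)

lemma restr_add: "restr P (f + g) = restr P f + restr P g"
  by (intro poly_mapping_eqI) (simp add: lookup_restr lookup_add)

lemma restr_sum: "restr P (sum f A) = (\<Sum>i \<in> A. restr P (f i))"
  by (induction A rule: infinite_finite_induct) (simp_all add: restr_add)

lemma restr_single: "restr P (Poly_Mapping.single t c) = (if P t then Poly_Mapping.single t c else 0)"
  by (intro poly_mapping_eqI) (auto simp: lookup_restr lookup_single when_def)

lemma restr_id: "(\<And>t. t \<in> keys f \<Longrightarrow> P t) \<Longrightarrow> restr P f = f"
  by (intro poly_mapping_eqI) (auto simp: lookup_restr in_keys_iff)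

lemma restr_eq_0: "(\<And>t. t \<in> keys f \<Longrightarrow> \<not> P t) \<Longrightarrow> restr P f = 0"
  by (intro poly_mapping_eqI) (auto simp: lookup_restr in_keys_iff)

lemma restr_as_sum: "restr P f = (\<Sum>t \<in> keys f. if P t then Poly_Mapping.single t (lookup f t) else 0)"
  by (subst sum_single_lookup [symmetric], unfold restr_sum) (simp add: restr_single)

text \<open>Multiplication by \<open>h\<close> shifts the condition \<open>Q\<close> to
  \<open>P\<close>. In this way the projection to a degree or bidegree passes through a homogeneous
  factor.\<close>

lemma restr_mult_left:
  fixes f h :: "'a::monoid_add \<Rightarrow>\<^sub>0 'b::semiring_0"
  assumes "\<And>s t. s \<in> keys h \<Longrightarrow> t \<in> keys f \<Longrightarrow> P (s + t) \<longleftrightarrow> Q t"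
  shows "restr P (h * f) = h * restr Q f"
proof -
  have "h * restr Q f = (\<Sum>s \<in> keys h. Poly_Mapping.single s (lookup h s)) *
      (\<Sum>t \<in> keys f. if Q t then Poly_Mapping.single t (lookup f t) else 0)"
    by (simp add: sum_single_lookup restr_as_sum)
  also have "\<dots> = (\<Sum>s \<in> keys h. \<Sum>t \<in> keys f.
      if Q t then Poly_Mapping.single (s + t) (lookup h s * lookup f t) else 0)"
    by (simp add: sum_product mult_single if_distrib cong: if_cong)
  also have "\<dots> = restr P (h * f)"
    unfolding times_expand [of h f] restr_sum restr_single using assms
    by (intro sum.cong refl) auto
  finally show ?thesis ..
qed

text \<open>By hypothesis the monomials with \<open>P\<close> are closed under products and
  divisors, so the others span an ideal and the projection is multiplicative.\<close>

lemma restr_mult: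
  fixes f g :: "'a::monoid_add \<Rightarrow>\<^sub>0 'b::semiring_0"
  assumes "\<And>s t. P (s + t) \<longleftrightarrow> P s \<and> P t"
  shows "restr P (f * g) = restr P f * restr P g"
proof -
  have "restr P f * restr P g =
      (\<Sum>s \<in> keys f. if P s then Poly_Mapping.single s (lookup f s) else 0) *
      (\<Sum>t \<in> keys g. if P t then Poly_Mapping.single t (lookup g t) else 0)"
    by (simp add: restr_as_sum)
  also have "\<dots> = (\<Sum>s \<in> keys f. \<Sum>t \<in> keys g.
      if P (s + t) then Poly_Mapping.single (s + t) (lookup f s * lookup g t) else 0)"
    unfolding sum_product by (intro sum.cong refl) (auto simp: mult_single assms)
  also have "\<dots> = restr P (f * g)"
    by (simp add: times_expand [of f g] restr_sum restr_single)
  finally show ?thesis ..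
qed

text \<open>Arbitrary sets of variables instead of initial segments, because the reductions delete
  variables one at a time and in any order.\<close>

definition pset :: "nat set \<Rightarrow> 'a::comm_ring_1 mpoly set" where
  "pset U = {f. \<forall>t \<in> keys f. keys t \<subseteq> U}"

lemma polys_eq_pset: "polys N = pset {1..N}"
  by (simp add: polys_def pset_def)

lemma pset_0 [simp, intro]: "0 \<in> pset U"
  and pset_single: "keys t \<subseteq> U \<Longrightarrow> Poly_Mapping.single t c \<in> pset U"
  by (auto simp: pset_def)

lemma pset_const [simp, intro]: "const c \<in> pset U"
  and pset_1 [simp, intro]: "1 \<in> pset U"
  by (auto simp: const_def pset_def)

lemma pset_var: "i \<in> U \<Longrightarrow> var i \<in> pset U"
  by (auto simp: var_def pset_def)

lemma pset_add [intro]: "f \<in> pset U \<Longrightarrow> g \<in> pset U \<Longrightarrow> f + g \<in> pset U"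
  and pset_minus [intro]: "f \<in> pset U \<Longrightarrow> - f \<in> pset U"
  and pset_mult [intro]: "f \<in> pset U \<Longrightarrow> g \<in> pset U \<Longrightarrow> f * g \<in> pset U"
proof -
  show "f \<in> pset U \<Longrightarrow> g \<in> pset U \<Longrightarrow> f + g \<in> pset U"
    using keys_add [of f g] unfolding pset_def by blast
  show "f \<in> pset U \<Longrightarrow> - f \<in> pset U"
    by (auto simp: pset_def in_keys_iff)
  assume "f \<in> pset U" "g \<in> pset U"
  then show "f * g \<in> pset U"
    using keys_mult [of f g] unfolding pset_def by (fastforce simp: keys_plus_nat)
qed

lemma pset_diff [intro]: "f \<in> pset U \<Longrightarrow> g \<in> pset U \<Longrightarrow> f - g \<in> pset U"
  using pset_add [of f U "- g"] pset_minus [of g U] by simp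

lemma pset_sum: "(\<And>i. i \<in> A \<Longrightarrow> f i \<in> pset U) \<Longrightarrow> sum f A \<in> pset U"
  by (induction A rule: infinite_finite_induct) auto

lemma pset_restr: "f \<in> pset U \<Longrightarrow> restr P f \<in> pset U"
  by (auto simp: pset_def keys_restr)

lemma pset_mono: "f \<in> pset U \<Longrightarrow> U \<subseteq> V \<Longrightarrow> f \<in> pset V"
  by (auto simp: pset_def)

lemma pset_empty: "f \<in> pset {} \<Longrightarrow> f = const (lookup f 0)"
  by (intro poly_mapping_eqI) (auto simp: pset_def const_def lookup_single when_def in_keys_iff)

lemma const_0 [simp]: "const 0 = 0" and const_add: "const (a + b) = const a + const b"
  and const_mult: "const (a * b) = const a * const b"
  and const_minus: "const (- a) = - const a"
  and const_1 [simp]: "const 1 = 1"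
  by (simp_all add: const_def single_add mult_single single_uminus)

lemma const_inj [simp]: "const a = const b \<longleftrightarrow> a = b"
  by (metis const_def lookup_single_eq)

lemma var_nonzero [simp]: "var i \<noteq> 0"
  by (metis lookup_single_eq lookup_zero one_neq_zero var_def)

subsection \<open>Setting variables to zero\<close>

text \<open>The quotient by the variables in \<open>V\<close> is realised inside the same type, as
  the subring \<open>pset (U - V)\<close> with \<open>kill V\<close> as the projection.\<close>

definition kill :: "nat set \<Rightarrow> 'a::comm_ring_1 mpoly \<Rightarrow> 'a mpoly" where
  "kill V f = restr (\<lambda>t. keys t \<inter> V = {}) f"

lemma kill_0 [simp]: "kill V 0 = 0"
  and kill_add: "kill V (f + g) = kill V f + kill V g"
  and kill_sum: "kill V (sum h A) = (\<Sum>i \<in> A. kill V (h i))"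
  and kill_mult: "kill V (f * g) = kill V f * kill V g"
  by (auto simp: kill_def restr_add restr_sum keys_plus_nat intro!: restr_mult)

lemma kill_pset: "f \<in> pset U \<Longrightarrow> kill V f \<in> pset (U - V)"
  by (auto simp: kill_def pset_def keys_restr)

lemma kill_id: "f \<in> pset U \<Longrightarrow> U \<inter> V = {} \<Longrightarrow> kill V f = f"
  unfolding kill_def pset_def by (intro restr_id) auto

lemma kill_kill: "kill V (kill W f) = kill (V \<union> W) f"
  by (intro poly_mapping_eqI) (auto simp: kill_def lookup_restr)

lemma kill_const [simp]: "kill V (const c) = const c"
  by (auto simp: kill_def const_def restr_single)

lemma kill_var: "kill V (var i) = (if i \<in> V then 0 else var i)"
  by (auto simp: kill_def var_def restr_single)

text \<open>Division by a variable. It shows that the elements of \<open>pset U\<close> that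
  \<open>kill {x}\<close> annihilates are multiples of \<open>var x\<close>.\<close>

lemma kill_decomp:
  assumes "f \<in> pset U" "x \<in> U"
  obtains g where "g \<in> pset U" "f = kill {x} f + var x * g"
proof -
  define g where "g = (\<Sum>t \<in> keys f. if x \<in> keys t
    then Poly_Mapping.single (t - Poly_Mapping.single x 1) (lookup f t) else 0)"
  have 1: "keys (t - Poly_Mapping.single x 1) \<subseteq> keys t" for t :: "nat \<Rightarrow>\<^sub>0 nat"
    by (auto simp: in_keys_iff lookup_minus)
  have g: "g \<in> pset U"
    unfolding g_def using 1 assms(1)
    by (intro pset_sum) (force simp: pset_def intro: pset_single)
  have 2: "Poly_Mapping.single x 1 + (t - Poly_Mapping.single x 1) = t" if "x \<in> keys t"
    for t :: "nat \<Rightarrow>\<^sub>0 nat"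
    using that
    by (intro poly_mapping_eqI) (auto simp: lookup_add lookup_minus lookup_single when_def in_keys_iff)
  have "var x * g = (\<Sum>t \<in> keys f. if x \<in> keys t then Poly_Mapping.single t (lookup f t) else 0)"
    by (simp add: g_def sum_distrib_left if_distrib var_def mult_single 2 [unfolded One_nat_def] cong: if_cong)
  moreover have "kill {x} f = (\<Sum>t \<in> keys f. if x \<in> keys t then 0 else Poly_Mapping.single t (lookup f t))"
    unfolding kill_def restr_as_sum by (intro sum.cong) auto
  ultimately have "kill {x} f + var x * g = (\<Sum>t \<in> keys f.
      (if x \<in> keys t then 0 else Poly_Mapping.single t (lookup f t))
      + (if x \<in> keys t then Poly_Mapping.single t (lookup f t) else 0))"
    by (simp only: sum.distrib)
  also have "\<dots> = (\<Sum>t \<in> keys f. Poly_Mapping.single t (lookup f t))"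
    by (intro sum.cong) auto
  finally have "f = kill {x} f + var x * g"
    by (simp only: sum_single_lookup)
  with g that show thesis by blast
qed

section \<open>Vectors and matrices of polynomials\<close>

text \<open>Vectors are plain functions, so that zero, sums and differences are the pointwise ones
  and ranks do not enter the operations.\<close>

definition smul :: "'r::comm_ring_1 \<Rightarrow> (nat \<Rightarrow> 'r) \<Rightarrow> nat \<Rightarrow> 'r" where
  "smul a w = (\<lambda>k. a * w k)"

definition mat_app :: "nat \<Rightarrow> (nat \<Rightarrow> nat \<Rightarrow> 'r::comm_ring_1) \<Rightarrow> (nat \<Rightarrow> 'r) \<Rightarrow> nat \<Rightarrow> 'r" where
  "mat_app b A w = (\<lambda>k. \<Sum>j<b. A k j * w j)"

text \<open>
  An element of the free module of rank \<open>b\<close> is a function on \<open>nat\<close> that vanishes from \<open>b\<close> on.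
\<close>

definition fm :: "nat set \<Rightarrow> nat \<Rightarrow> (nat \<Rightarrow> 'a::comm_ring_1 mpoly) set" where
  "fm U b = {w. (\<forall>k. w k \<in> pset U) \<and> (\<forall>k \<ge> b. w k = 0)}"

text \<open>Only the number of rows is bounded here; the number of columns is the first argument of
  \<open>mat_app\<close>.\<close>

definition fmats :: "nat set \<Rightarrow> nat \<Rightarrow> (nat \<Rightarrow> nat \<Rightarrow> 'a::comm_ring_1 mpoly) set" where
  "fmats U a = {A. \<forall>j. (\<lambda>k. A k j) \<in> fm U a}"

definition killv :: "nat set \<Rightarrow> (nat \<Rightarrow> 'a::comm_ring_1 mpoly) \<Rightarrow> nat \<Rightarrow> 'a mpoly" where
  "killv V w = (\<lambda>k. kill V (w k))"

definition killm ::
  "nat set \<Rightarrow> (nat \<Rightarrow> nat \<Rightarrow> 'a::comm_ring_1 mpoly) \<Rightarrow> nat \<Rightarrow> nat \<Rightarrow> 'a mpoly" where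
  "killm V A = (\<lambda>k j. kill V (A k j))"

lemma smul_add: "smul a (v + w) = smul a v + smul a w"
  and smul_diff: "smul a (v - w) = smul a v - smul a w"
  and smul_0 [simp]: "smul a 0 = 0"
  and smul_1 [simp]: "smul 1 w = w"
  and smul_smul: "smul a (smul a' w) = smul (a * a') w"
  and smul_minus_left: "smul (- a) w = - smul a w"
  by (auto simp: smul_def fun_eq_iff algebra_simps)

lemma smul_commute: "smul a (smul a' w) = smul a' (smul a w)"
  by (auto simp: smul_def fun_eq_iff algebra_simps)

lemma sum_fun_apply: "(\<Sum>i \<in> I. f i) k = (\<Sum>i \<in> I. f i k)" for f :: "'i \<Rightarrow> 'b \<Rightarrow> 'c::comm_monoid_add"
  by (induction I rule: infinite_finite_induct) auto

lemma smul_sum: "smul a (\<Sum>i \<in> I. f i) = (\<Sum>i \<in> I. smul a (f i))"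
  by (auto simp: smul_def fun_eq_iff sum_fun_apply sum_distrib_left)

lemma smul_cancel: "a \<noteq> 0 \<Longrightarrow> smul a v = smul a w \<longleftrightarrow> v = w" for a :: "'r::idom"
  by (auto simp: smul_def fun_eq_iff)

lemma mat_app_add: "mat_app b A (v + w) = mat_app b A v + mat_app b A w"
  and mat_app_diff: "mat_app b A (v - w) = mat_app b A v - mat_app b A w"
  and mat_app_0 [simp]: "mat_app b A 0 = 0"
  and mat_app_smul: "mat_app b A (smul a w) = smul a (mat_app b A w)"
  by (auto simp: mat_app_def smul_def fun_eq_iff algebra_simps sum.distrib sum_subtractf
      sum_distrib_left)

lemma mat_app_sum: "mat_app b A (\<Sum>i \<in> I. f i) = (\<Sum>i \<in> I. mat_app b A (f i))"
  by (induction I rule: infinite_finite_induct)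
    (simp_all only: sum.infinite sum.empty sum.insert mat_app_0 mat_app_add not_False_eq_True)

lemma fm_0 [simp, intro]: "0 \<in> fm U b"
  and fm_add [intro]: "v \<in> fm U b \<Longrightarrow> w \<in> fm U b \<Longrightarrow> v + w \<in> fm U b"
  and fm_diff [intro]: "v \<in> fm U b \<Longrightarrow> w \<in> fm U b \<Longrightarrow> v - w \<in> fm U b"
  and fm_smul: "a \<in> pset U \<Longrightarrow> w \<in> fm U b \<Longrightarrow> smul a w \<in> fm U b"
  by (auto simp: fm_def smul_def)

lemma fm_sum: "(\<And>i. i \<in> I \<Longrightarrow> f i \<in> fm U b) \<Longrightarrow> sum f I \<in> fm U b"
  by (induction I rule: infinite_finite_induct) auto

lemma fm_mono: "w \<in> fm U b \<Longrightarrow> U \<subseteq> V \<Longrightarrow> w \<in> fm V b"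
  by (auto simp: fm_def intro: pset_mono)

lemma fm_mat_app: "A \<in> fmats U a \<Longrightarrow> w \<in> fm U b \<Longrightarrow> mat_app b A w \<in> fm U a"
  by (auto simp: fmats_def fm_def mat_app_def intro!: pset_sum)

lemma killv_0 [simp]: "killv V 0 = 0"
  and killv_add: "killv V (v + w) = killv V v + killv V w"
  and killv_smul: "killv V (smul a w) = smul (kill V a) (killv V w)"
  by (auto simp: killv_def fun_eq_iff kill_add smul_def kill_mult)

lemma killv_diff: "killv V (v - w) = killv V v - killv V w"
  using killv_add [of V "v - w" w] by simp

lemma killv_sum: "killv V (\<Sum>i \<in> I. f i) = (\<Sum>i \<in> I. killv V (f i))"
  by (induction I rule: infinite_finite_induct)
    (simp_all only: sum.infinite sum.empty sum.insert killv_0 killv_add not_False_eq_True)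

lemma killv_mat_app: "killv V (mat_app b A w) = mat_app b (killm V A) (killv V w)"
  by (auto simp: killv_def killm_def mat_app_def kill_sum kill_mult)

lemma fm_killv: "w \<in> fm U b \<Longrightarrow> killv V w \<in> fm (U - V) b"
  by (auto simp: fm_def killv_def kill_pset)

lemma killv_id: "w \<in> fm U b \<Longrightarrow> U \<inter> V = {} \<Longrightarrow> killv V w = w"
  unfolding fm_def killv_def by (intro ext kill_id [of _ U]) auto

lemma fmats_killm: "A \<in> fmats U a \<Longrightarrow> killm V A \<in> fmats (U - V) a"
  by (auto simp: fmats_def fm_def killm_def kill_pset)

lemma killv_decomp:
  assumes "w \<in> fm U b" "x \<in> U"
  obtains g where "g \<in> fm U b" "w = killv {x} w + smul (var x) g"
proof -
  have "\<exists>g. g \<in> pset U \<and> w k = kill {x} (w k) + var x * g" for k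
    using assms kill_decomp [of "w k" U x] by (metis (mono_tags, lifting) fm_def mem_Collect_eq)
  then obtain g where g: "\<And>k. g k \<in> pset U" "\<And>k. w k = kill {x} (w k) + var x * g k"
    by metis
  have "(\<lambda>k. if k < b then g k else 0) \<in> fm U b"
    using g by (auto simp: fm_def)
  moreover have "w = killv {x} w + smul (var x) (\<lambda>k. if k < b then g k else 0)"
    using g assms by (auto simp: fm_def killv_def smul_def fun_eq_iff)
  ultimately show thesis
    using that by blast
qed

lemma killv_image:
  assumes "I \<subseteq> pset U"
  shows "killv V ` {w \<in> fm U 1. w 0 \<in> I} = {w \<in> fm (U - V) 1. w 0 \<in> kill V ` I}"
proof (intro equalityI subsetI)
  fix w assume "w \<in> killv V ` {w \<in> fm U 1. w 0 \<in> I}"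
  then obtain v where "v \<in> fm U 1" "v 0 \<in> I" "w = killv V v"
    by blast
  then show "w \<in> {w \<in> fm (U - V) 1. w 0 \<in> kill V ` I}"
    using fm_killv by (auto simp: killv_def)
next
  fix w assume "w \<in> {w \<in> fm (U - V) 1. w 0 \<in> kill V ` I}"
  then obtain f where w: "w \<in> fm (U - V) 1" "f \<in> I" "w 0 = kill V f"
    by blast
  define v where "v k = (if k = 0 then f else 0)" for k :: nat
  have "v \<in> fm U 1"
    using assms w(2) by (auto simp: v_def fm_def)
  moreover have "w k = killv V v k" for k
    using w(1,3) by (cases k) (auto simp: killv_def v_def fm_def)
  then have "w = killv V v" ..
  ultimately show "w \<in> killv V ` {w \<in> fm U 1. w 0 \<in> I}"
    using w(2) by (intro image_eqI [of _ _ v]) (simp_all add: v_def)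
qed

section \<open>Acyclic complexes of free modules\<close>

text \<open>\<open>A i\<close> is the map from F_(i+1) to F_i, so \<open>im U b A i\<close> is a
  submodule of F_i.\<close>

definition im ::
  "nat set \<Rightarrow> (nat \<Rightarrow> nat) \<Rightarrow> (nat \<Rightarrow> nat \<Rightarrow> nat \<Rightarrow> 'a::comm_ring_1 mpoly) \<Rightarrow> nat \<Rightarrow>
    (nat \<Rightarrow> 'a mpoly) set" where
  "im U b A i = mat_app (b (Suc i)) (A i) ` fm U (b (Suc i))"

text \<open>Exactness is required at F_1, F_2, ..., but not at F_0: the complex resolves the
  cokernel of \<open>A 0\<close>.\<close>

definition acyclic_complex ::
  "nat set \<Rightarrow> (nat \<Rightarrow> nat) \<Rightarrow> (nat \<Rightarrow> nat \<Rightarrow> nat \<Rightarrow> 'a::comm_ring_1 mpoly) \<Rightarrow> bool" where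
  "acyclic_complex U b A \<longleftrightarrow>
     (\<forall>i. A i \<in> fmats U (b i)) \<and>
     (\<forall>i. {w \<in> fm U (b (Suc i)). mat_app (b (Suc i)) (A i) w = 0} = im U b A (Suc i))"

text \<open>The preimage, in the free module, of the socle of its quotient by \<open>Z\<close>. For
  \<open>U = {}\<close> it is the whole free module.\<close>

definition soc :: "nat set \<Rightarrow> nat \<Rightarrow> (nat \<Rightarrow> 'a::comm_ring_1 mpoly) set \<Rightarrow> (nat \<Rightarrow> 'a mpoly) set" where
  "soc U b Z = {w \<in> fm U b. \<forall>v \<in> U. smul (var v) w \<in> Z}"

text \<open>This stands for a vector space basis of \<open>W / Z\<close> over the constants, given
  by representatives.\<close>

definition basis_mod ::
  "nat \<Rightarrow> (nat \<Rightarrow> nat \<Rightarrow> 'a::comm_ring_1 mpoly) \<Rightarrow> (nat \<Rightarrow> 'a mpoly) set \<Rightarrow> (nat \<Rightarrow> 'a mpoly) set \<Rightarrow> bool"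
where
  "basis_mod s w W Z \<longleftrightarrow>
     (\<forall>i<s. w i \<in> W) \<and>
     (\<forall>v \<in> W. \<exists>c. v - (\<Sum>i<s. smul (const (c i)) (w i)) \<in> Z) \<and>
     (\<forall>c. (\<Sum>i<s. smul (const (c i)) (w i)) \<in> Z \<longrightarrow> (\<forall>i<s. c i = 0))"

lemma acyclic_complexD:
  assumes "acyclic_complex U b A"
  shows "A i \<in> fmats U (b i)"
    and "w \<in> fm U (b (Suc (Suc i))) \<Longrightarrow>
      mat_app (b (Suc i)) (A i) (mat_app (b (Suc (Suc i))) (A (Suc i)) w) = 0"
    and "w \<in> fm U (b (Suc i)) \<Longrightarrow> mat_app (b (Suc i)) (A i) w = 0 \<Longrightarrow>
      \<exists>y \<in> fm U (b (Suc (Suc i))). w = mat_app (b (Suc (Suc i))) (A (Suc i)) y"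
  using assms unfolding acyclic_complex_def im_def by blast+

lemma acyclic_complex_Suc: "acyclic_complex U b A \<Longrightarrow> acyclic_complex U (\<lambda>i. b (Suc i)) (\<lambda>i. A (Suc i))"
  by (auto simp: acyclic_complex_def im_def)

lemma im_kill: 
  assumes "acyclic_complex U b A"
  shows "im (U - V) b (\<lambda>i. killm V (A i)) i = killv V ` im U b A i"
proof
  have "mat_app (b (Suc i)) (killm V (A i)) w \<in> killv V ` im U b A i"
    if "w \<in> fm (U - V) (b (Suc i))" for w
  proof -
    have "killv V (mat_app (b (Suc i)) (A i) w) = mat_app (b (Suc i)) (killm V (A i)) w"
      using killv_id [OF that, of V] by (simp add: killv_mat_app Int_commute)
    moreover have "w \<in> fm U (b (Suc i))"
      using that by (auto intro: fm_mono)
    ultimately show ?thesis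
      unfolding im_def by (metis imageI)
  qed
  then show "im (U - V) b (\<lambda>i. killm V (A i)) i \<subseteq> killv V ` im U b A i"
    by (auto simp: im_def)
  show "killv V ` im U b A i \<subseteq> im (U - V) b (\<lambda>i. killm V (A i)) i"
    by (auto simp: im_def killv_mat_app intro: fm_killv)
qed

text \<open>The hypothesis \<open>reg\<close> says that x is regular on the cokernel of
  \<open>A 0\<close>. A cycle w modulo x satisfies A w = x u. Here u is a boundary: for i = 0 by
  \<open>reg\<close>, otherwise because x can be cancelled and the complex is exact at u. With u = A
  v, the vector w - x v is a true cycle that has the same reduction as w.\<close>

lemma acyclic_complex_kill:
  fixes A :: "nat \<Rightarrow> nat \<Rightarrow> nat \<Rightarrow> 'a::idom mpoly"
  assumes ac: "acyclic_complex U b A" and x: "x \<in> U"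
    and reg: "\<And>w. w \<in> fm U (b 0) \<Longrightarrow> smul (var x) w \<in> im U b A 0 \<Longrightarrow> w \<in> im U b A 0"
  shows "acyclic_complex (U - {x}) b (\<lambda>i. killm {x} (A i))"
  unfolding acyclic_complex_def
proof (intro conjI allI equalityI subsetI)
  note D = acyclic_complexD [OF ac]
  fix i
  show "killm {x} (A i) \<in> fmats (U - {x}) (b i)"
    by (rule fmats_killm [OF D(1)])
  {
    fix w assume "w \<in> im (U - {x}) b (\<lambda>i. killm {x} (A i)) (Suc i)"
    then obtain y where y: "y \<in> fm U (b (Suc (Suc i)))"
      and w: "w = killv {x} (mat_app (b (Suc (Suc i))) (A (Suc i)) y)"
      unfolding im_kill [OF ac] by (auto simp: im_def)
    have "w \<in> fm (U - {x}) (b (Suc i))"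
      unfolding w using D(1) y by (intro fm_killv fm_mat_app)
    moreover have "mat_app (b (Suc i)) (killm {x} (A i)) w = 0"
      unfolding w using D(2) [OF y] by (simp flip: killv_mat_app)
    ultimately show "w \<in> {w \<in> fm (U - {x}) (b (Suc i)). mat_app (b (Suc i)) (killm {x} (A i)) w = 0}"
      by simp
  }
  fix w assume "w \<in> {w \<in> fm (U - {x}) (b (Suc i)). mat_app (b (Suc i)) (killm {x} (A i)) w = 0}"
  then have w: "w \<in> fm (U - {x}) (b (Suc i))" "mat_app (b (Suc i)) (killm {x} (A i)) w = 0"
    by auto
  have wU: "w \<in> fm U (b (Suc i))"
    using w(1) by (rule fm_mono) auto
  have kw: "killv {x} w = w"
    using w(1) by (rule killv_id) auto
  obtain u where u: "u \<in> fm U (b i)" "mat_app (b (Suc i)) (A i) w = smul (var x) u"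
    using killv_decomp [OF fm_mat_app [OF D(1) [of i] wU] x] w(2) kw
    by (simp add: killv_mat_app) blast
  have "u \<in> im U b A i"
  proof (cases i)
    case 0
    with u reg wU show ?thesis
      by (metis im_def imageI)
  next
    case (Suc i')
    then have "smul (var x) (mat_app (b i) (A i') u) = 0"
      using D(2) [of w i'] wU u by (simp add: mat_app_smul)
    then have "mat_app (b i) (A i') u = 0"
      using smul_cancel [of "var x" _ 0] by auto
    with D(3) [of u i'] u Suc show ?thesis
      by (auto simp: im_def)
  qed
  then obtain v where v: "v \<in> fm U (b (Suc i))" "u = mat_app (b (Suc i)) (A i) v"
    by (auto simp: im_def)
  have "mat_app (b (Suc i)) (A i) (w - smul (var x) v) = 0"
    using u v by (simp add: mat_app_diff mat_app_smul)
  then obtain y where y: "y \<in> fm U (b (Suc (Suc i)))"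
    "w - smul (var x) v = mat_app (b (Suc (Suc i))) (A (Suc i)) y"
    using D(3) [of "w - smul (var x) v" i] wU v x by (auto intro: fm_smul pset_var)
  have "killv {x} (w - smul (var x) v) = w"
    by (simp add: killv_diff kw killv_smul kill_var) (simp add: smul_def fun_eq_iff)
  with y show "w \<in> im (U - {x}) b (\<lambda>i. killm {x} (A i)) (Suc i)"
    unfolding im_kill [OF ac] by (auto simp: im_def)
qed

text \<open>The cokernel of \<open>A 1\<close> embeds by \<open>A 0\<close> into the free module
  F_0, on which x is regular. Hence the complex truncated at F_1 can always be reduced modulo a
  variable.\<close>

lemma smul_var_in_im:
  fixes A :: "nat \<Rightarrow> nat \<Rightarrow> nat \<Rightarrow> 'a::idom mpoly"
  assumes ac: "acyclic_complex U b A"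
    and w: "w \<in> fm U (b (Suc 0))" "smul (var x) w \<in> im U b A (Suc 0)"
  shows "w \<in> im U b A (Suc 0)"
proof -
  note D = acyclic_complexD [OF ac]
  obtain v where "v \<in> fm U (b (Suc (Suc 0)))" "smul (var x) w = mat_app (b (Suc (Suc 0))) (A (Suc 0)) v"
    using w(2) unfolding im_def by blast
  then have "smul (var x) (mat_app (b (Suc 0)) (A 0) w) = 0"
    using D(2) [of v 0] by (simp flip: mat_app_smul)
  then have "mat_app (b (Suc 0)) (A 0) w = 0"
    using smul_cancel [of "var x" _ 0] by auto
  with D(3) [of w 0] w(1) show ?thesis
    by (auto simp: im_def)
qed

text \<open>
  If \<open>Z\<close> is the image of \<open>F\<^sub>1\<close> in \<open>F\<^sub>0\<close>, then \<open>w \<mapsto> x w\<close> induces an isomorphism from the socle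
  of \<open>F\<^sub>0 / Z\<close> onto the socle of \<open>Z / x Z\<close> over the ring without \<open>x\<close>: if \<open>z \<in> Z\<close>
  and \<open>v z = x z'\<close> for another variable \<open>v\<close>, then \<open>x\<close> divides \<open>z\<close> in \<open>F\<^sub>0\<close>. When there is no
  other variable, \<open>x\<close> divides \<open>z\<close> because the resolution is minimal.
\<close>

lemma basis_mod_soc_step:
  fixes A :: "nat \<Rightarrow> nat \<Rightarrow> nat \<Rightarrow> 'a::idom mpoly"
  assumes ac: "acyclic_complex U b A" and x: "x \<in> U"
    and min: "\<And>k j. lookup (A 0 k j) 0 = 0"
    and w: "basis_mod s w (soc U (b 0) (im U b A 0)) (im U b A 0)"
  shows "\<exists>w'. basis_mod s w' (soc (U - {x}) (b 1) (im (U - {x}) b (\<lambda>i. killm {x} (A i)) 1))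
    (im (U - {x}) b (\<lambda>i. killm {x} (A i)) 1)"
proof -
  note D = acyclic_complexD [OF ac]
  define L where "L = mat_app (b 1) (A 0)"
  define L1 where "L1 = mat_app (b 2) (A 1)"
  have L: "L v \<in> fm U (b 0)" if "v \<in> fm U (b 1)" for v
    unfolding L_def using D(1) that by (rule fm_mat_app)
  have L1: "L1 v \<in> fm U (b 1)" if "v \<in> fm U (b 2)" for v
    unfolding L1_def using D(1) that by (rule fm_mat_app)
  have LL1: "L (L1 v) = 0" if "v \<in> fm U (b 2)" for v
    using D(2) [of v 0] that by (simp add: L_def L1_def numeral_2_eq_2)
  have ex: "\<exists>y \<in> fm U (b 2). v = L1 y" if "v \<in> fm U (b 1)" "L v = 0" for v
    using D(3) [of v 0] that by (simp add: L_def L1_def numeral_2_eq_2)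
  have im0: "im U b A 0 = L ` fm U (b 1)"
    by (simp add: im_def L_def)
  have im1: "im (U - {x}) b (\<lambda>i. killm {x} (A i)) 1 = killv {x} ` L1 ` fm U (b 2)"
    using im_kill [OF ac, of "{x}" 1] by (simp add: im_def L1_def numeral_2_eq_2)
  note Lin = mat_app_add [of "b 1" "A 0", folded L_def] mat_app_diff [of "b 1" "A 0", folded L_def]
    mat_app_smul [of "b 1" "A 0", folded L_def] mat_app_sum [of "b 1" "A 0", folded L_def]
  have Lsum: "L (\<Sum>i<s. smul (const (c i)) (f i)) = (\<Sum>i<s. smul (const (c i)) (L (f i)))" for c f
    by (simp add: Lin)
  note X = killv_add killv_diff killv_smul killv_sum kill_var
  have kx: "killv {x} (smul (var x) g) = 0" for g
    by (simp add: X) (simp add: smul_def fun_eq_iff)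
  note vx = pset_var [OF x]
  have wS: "w i \<in> fm U (b 0)" "\<And>v. v \<in> U \<Longrightarrow> smul (var v) (w i) \<in> L ` fm U (b 1)" if "i < s" for i
    using w that by (auto simp: basis_mod_def soc_def im0)
  \<comment> \<open>Origin of the new basis: x times \<open>w i\<close> lies in Z and
    \<open>y i\<close> is a preimage in F_1; the reductions of the \<open>y i\<close> represent the
    classes in Z / x Z.\<close>
  have "\<exists>y. y \<in> fm U (b 1) \<and> L y = smul (var x) (w i)" if "i < s" for i
    using wS(2) [OF that x] by (metis imageE)
  then obtain y where y: "\<And>i. i < s \<Longrightarrow> y i \<in> fm U (b 1)" "\<And>i. i < s \<Longrightarrow> L (y i) = smul (var x) (w i)"
    by metis
  have ysum: "(\<Sum>i<s. smul (const (c i)) (y i)) \<in> fm U (b 1)" for c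
    using y by (intro fm_sum fm_smul) auto
  have Lysum: "L (\<Sum>i<s. smul (const (c i)) (y i)) = smul (var x) (\<Sum>i<s. smul (const (c i)) (w i))" for c
    using y(2) unfolding Lsum smul_sum by (intro sum.cong) (simp_all add: smul_commute)
  have kysum: "(\<Sum>i<s. smul (const (c i)) (killv {x} (y i))) = killv {x} (\<Sum>i<s. smul (const (c i)) (y i))"
    for c by (simp add: X)
  define Z' where "Z' = killv {x} ` L1 ` fm U (b 2)"
  have "basis_mod s (\<lambda>i. killv {x} (y i)) (soc (U - {x}) (b 1) Z') Z'"
    unfolding basis_mod_def
  proof (intro conjI allI impI ballI)
    fix i assume i: "i < s"
    have "smul (var v) (killv {x} (y i)) \<in> Z'" if v: "v \<in> U" "v \<noteq> x" for v
    proof -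
      obtain z where z: "z \<in> fm U (b 1)" "smul (var v) (w i) = L z"
        using wS(2) [OF i v(1)] by (metis imageE)
      have "L (smul (var v) (y i) - smul (var x) z) = 0"
        by (simp add: Lin y(2) [OF i] smul_smul mult.commute flip: z(2))
      then obtain t where "t \<in> fm U (b 2)" "smul (var v) (y i) - smul (var x) z = L1 t"
        using ex [of "smul (var v) (y i) - smul (var x) z"] y(1) [OF i] z v x
        by (auto intro: fm_smul pset_var)
      moreover have "killv {x} (smul (var v) (y i) - smul (var x) z) = smul (var v) (killv {x} (y i))"
        using v by (simp add: killv_diff kx) (simp add: X)
      ultimately show ?thesis
        unfolding Z'_def by (metis imageI)
    qed
    then show "killv {x} (y i) \<in> soc (U - {x}) (b 1) Z'"
      using fm_killv [OF y(1) [OF i], of "{x}"] by (auto simp: soc_def)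
  next
    fix u assume u: "u \<in> soc (U - {x}) (b 1) Z'"
    then have "u \<in> fm (U - {x}) (b 1)"
      by (auto simp: soc_def)
    then have uU: "u \<in> fm U (b 1)" and ku: "killv {x} u = u"
      by (auto intro: fm_mono killv_id)
    \<comment> \<open>Once x is set to zero, \<open>smul (var v) u\<close> becomes a boundary
      \<open>L1 t\<close>. So the two differ by a multiple x g, and \<open>L\<close> annihilates
      \<open>L1 t\<close>.\<close>
    have *: "\<exists>g \<in> fm U (b 1). smul (var v) (L u) = smul (var x) (L g)" if v: "v \<in> U" "v \<noteq> x" for v
    proof -
      obtain t where t: "t \<in> fm U (b 2)" "smul (var v) u = killv {x} (L1 t)"
        using u v by (auto simp: soc_def Z'_def)
      have d: "smul (var v) u - L1 t \<in> fm U (b 1)"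
        by (intro fm_diff fm_smul pset_var v(1) uU L1 t(1))
      obtain g where g: "g \<in> fm U (b 1)"
        "smul (var v) u - L1 t = killv {x} (smul (var v) u - L1 t) + smul (var x) g"
        by (rule killv_decomp [OF d x])
      have "killv {x} (smul (var v) u) = smul (var v) u"
        using v by (simp add: killv_smul kill_var ku)
      then have "killv {x} (smul (var v) u - L1 t) = 0"
        by (simp only: killv_diff t(2) [symmetric]) simp
      then have "smul (var v) u - L1 t = smul (var x) g"
        using g by simp
      then have "L (smul (var v) u - L1 t) = L (smul (var x) g)"
        by simp
      then have "smul (var v) (L u) = smul (var x) (L g)"
        using t(1) by (simp add: Lin LL1)
      with g(1) show ?thesis
        by blast
    qed
    have "killv {x} (L u) = 0"
    proof (cases "U = {x}")
      case True
      have "kill {x} (A 0 k j) = 0" for k j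
      proof -
        have "A 0 k j \<in> pset {x}"
          using D(1) [of 0] True by (auto simp: fmats_def fm_def)
        then have "kill {x} (A 0 k j) \<in> pset {}"
          using kill_pset [of _ "{x}" "{x}"] by simp
        then have "kill {x} (A 0 k j) = const (lookup (kill {x} (A 0 k j)) 0)"
          by (rule pset_empty)
        also have "lookup (kill {x} (A 0 k j)) 0 = 0"
          by (simp add: kill_def lookup_restr min)
        finally show ?thesis by simp
      qed
      then show ?thesis
        by (simp add: L_def killv_mat_app killm_def) (simp add: mat_app_def fun_eq_iff)
    next
      case False
      then obtain v where v: "v \<in> U" "v \<noteq> x"
        using x by blast
      then obtain g where "smul (var v) (L u) = smul (var x) (L g)"
        using * by blast
      then have "killv {x} (smul (var v) (L u)) = 0"
        by (simp add: kx)
      then have "smul (var v) (killv {x} (L u)) = 0"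
        using v by (simp add: X)
      then show ?thesis
        using smul_cancel [of "var v" _ 0] by auto
    qed
    moreover obtain w0 where "w0 \<in> fm U (b 0)" "L u = killv {x} (L u) + smul (var x) w0"
      by (rule killv_decomp [OF L [OF uU] x])
    ultimately have w0: "w0 \<in> fm U (b 0)" "L u = smul (var x) w0"
      by simp_all
    have "smul (var v) w0 \<in> L ` fm U (b 1)" if v: "v \<in> U" for v
    proof (cases "v = x")
      case True
      then show ?thesis using w0 uU by (metis imageI)
    next
      case False
      then obtain g where g: "g \<in> fm U (b 1)" "smul (var v) (L u) = smul (var x) (L g)"
        using * v by blast
      then have "smul (var x) (smul (var v) w0) = smul (var x) (L g)"
        using w0 by (metis smul_commute)
      then show ?thesis
        using g smul_cancel [of "var x"] by auto
    qed
    then have "w0 \<in> soc U (b 0) (im U b A 0)"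
      using w0 by (auto simp: soc_def im0)
    then obtain c h where h: "h \<in> fm U (b 1)" "w0 - (\<Sum>i<s. smul (const (c i)) (w i)) = L h"
      using w unfolding basis_mod_def im0 by blast
    \<comment> \<open>\<open>w0\<close> is the quotient of \<open>L u\<close> by x. Its expansion
      modulo Z lifts to F_1 up to a cycle, and the correction x h disappears under
      \<open>killv {x}\<close>.\<close>
    have "L (u - (\<Sum>i<s. smul (const (c i)) (y i)) - smul (var x) h) = 0"
      by (simp add: Lin(2) Lin(3) Lysum w0 flip: smul_diff h(2))
    then obtain t where t: "t \<in> fm U (b 2)" "u - (\<Sum>i<s. smul (const (c i)) (y i)) - smul (var x) h = L1 t"
      using ex [of "u - (\<Sum>i<s. smul (const (c i)) (y i)) - smul (var x) h"] uU ysum h vx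
      by (meson fm_diff fm_smul)
    have kt: "killv {x} (L1 t) = u - (\<Sum>i<s. smul (const (c i)) (killv {x} (y i)))"
      unfolding t(2) [symmetric] kysum by (simp only: killv_diff kx ku) simp
    show "\<exists>c. u - (\<Sum>i<s. smul (const (c i)) (killv {x} (y i))) \<in> Z'"
      unfolding Z'_def kt [symmetric] using t(1) by (intro exI [of _ c]) (simp only: kt [symmetric] imageI)
  next
    fix c i assume "(\<Sum>i<s. smul (const (c i)) (killv {x} (y i))) \<in> Z'" and i: "i < s"
    then obtain t where t: "t \<in> fm U (b 2)"
      "killv {x} (\<Sum>i<s. smul (const (c i)) (y i)) = killv {x} (L1 t)"
      unfolding Z'_def kysum by auto
    have d: "(\<Sum>i<s. smul (const (c i)) (y i)) - L1 t \<in> fm U (b 1)"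
      by (intro fm_diff ysum L1 t(1))
    obtain g where g: "g \<in> fm U (b 1)"
      "(\<Sum>i<s. smul (const (c i)) (y i)) - L1 t
        = killv {x} ((\<Sum>i<s. smul (const (c i)) (y i)) - L1 t) + smul (var x) g"
      by (rule killv_decomp [OF d x])
    have "(\<Sum>i<s. smul (const (c i)) (y i)) - L1 t = smul (var x) g"
      using g(2) by (simp only: killv_diff t(2)) simp
    then have "L ((\<Sum>i<s. smul (const (c i)) (y i)) - L1 t) = L (smul (var x) g)"
      by simp
    then have "smul (var x) (\<Sum>i<s. smul (const (c i)) (w i)) = smul (var x) (L g)"
      using t(1) by (simp only: Lin(2,3) Lysum LL1) simp
    then have "(\<Sum>i<s. smul (const (c i)) (w i)) \<in> im U b A 0"
      using g(1) smul_cancel [of "var x"] im0 by auto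
    then show "c i = 0"
      using w i unfolding basis_mod_def by blast
  qed
  then show ?thesis
    unfolding im1 Z'_def [symmetric] by blast
qed

section \<open>Dimension over the field\<close>

lemma (in vector_space) independent_family:
  fixes s :: nat
  assumes "\<And>c. (\<Sum>i<s. scale (c i) (v i)) = 0 \<Longrightarrow> (\<forall>i<s. c i = 0)"
  shows "inj_on v {..<s}" and "independent (v ` {..<s})"
proof -
  show inj: "inj_on v {..<s}"
  proof (rule inj_onI, rule ccontr)
    fix i j assume ij: "i \<in> {..<s}" "j \<in> {..<s}" "v i = v j" "i \<noteq> j"
    define c :: "nat \<Rightarrow> 'a" where "c k = (if k = i then 1 else 0) - (if k = j then 1 else 0)" for k
    have "(\<Sum>k<s. scale (c k) (v k)) = (\<Sum>k<s. if k = i then v k else 0) - (\<Sum>k<s. if k = j then v k else 0)"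
      unfolding c_def sum_subtractf [symmetric] by (intro sum.cong) (auto simp: algebra_simps)
    also have "\<dots> = 0"
      using ij by simp
    finally have "c i = 0"
      using assms ij by blast
    then show False
      using ij by (simp add: c_def)
  qed
  show "independent (v ` {..<s})"
  proof
    assume "dependent (v ` {..<s})"
    then obtain u where u: "\<exists>x \<in> v ` {..<s}. u x \<noteq> 0" "(\<Sum>x \<in> v ` {..<s}. scale (u x) x) = 0"
      by (auto simp: dependent_finite)
    have "(\<Sum>i<s. scale (u (v i)) (v i)) = 0"
      using u(2) inj by (simp add: sum.reindex)
    from assms [OF this] u(1) show False
      by blast
  qed
qed

lemma vector_space_smul: "vector_space (smul :: 'a::field \<Rightarrow> (nat \<Rightarrow> 'a) \<Rightarrow> nat \<Rightarrow> 'a)"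
  by unfold_locales (auto simp: smul_def fun_eq_iff algebra_simps)

text \<open>Without variables all entries are constants, so \<open>fm {} b\<close> is the coordinate
  space of dimension \<open>b\<close>, and the standard basis is compared with
  \<open>w\<close>.\<close>

lemma basis_mod_full:
  fixes w :: "nat \<Rightarrow> nat \<Rightarrow> 'a::field mpoly"
  assumes w: "basis_mod s w (fm {} b) {0}"
  shows "s = b"
proof -
  interpret V: vector_space "smul :: 'a \<Rightarrow> (nat \<Rightarrow> 'a) \<Rightarrow> nat \<Rightarrow> 'a"
    by (rule vector_space_smul)
  define v where "v i k = lookup (w i k) 0" for i k
  define e :: "nat \<Rightarrow> nat \<Rightarrow> 'a" where "e i k = (if k = i then 1 else 0)" for i k
  have wv: "w i k = const (v i k)" "k \<ge> b \<Longrightarrow> v i k = 0" if "i < s" for i k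
    using w that pset_empty [of "w i k"] by (auto simp: basis_mod_def fm_def v_def)
  have sum_const: "(\<Sum>i<s. smul (const (c i)) (w i)) = (\<lambda>k. const ((\<Sum>i<s. smul (c i) (v i)) k))" for c
  proof
    fix k
    have "(\<Sum>i<s. smul (const (c i)) (w i)) k = (\<Sum>i<s. const (c i * v i k))"
      unfolding sum_fun_apply by (intro sum.cong) (simp_all add: smul_def wv const_mult)
    also have "\<dots> = const (\<Sum>i<s. c i * v i k)"
      by (induction s) (simp_all add: const_add)
    finally show "(\<Sum>i<s. smul (const (c i)) (w i)) k = const ((\<Sum>i<s. smul (c i) (v i)) k)"
      by (simp add: sum_fun_apply smul_def)
  qed
  have indv: "\<forall>i<s. c i = 0" if "(\<Sum>i<s. smul (c i) (v i)) = 0" for c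
  proof -
    have "(\<Sum>i<s. smul (const (c i)) (w i)) = 0"
      unfolding sum_const that by (simp add: fun_eq_iff)
    then show ?thesis
      using w unfolding basis_mod_def by blast
  qed
  have sume: "(\<Sum>i<b. smul (c i) (e i)) = (\<lambda>k. if k < b then c k else 0)" for c
    by (auto simp: fun_eq_iff sum_fun_apply smul_def e_def if_distrib cong: if_cong)
  have inde: "\<forall>i<b. c i = 0" if "(\<Sum>i<b. smul (c i) (e i)) = 0" for c
  proof (intro allI impI)
    fix i assume "i < b"
    with fun_cong [OF that [unfolded sume], of i] show "c i = 0"
      by simp
  qed
  have "v ` {..<s} \<subseteq> V.span (e ` {..<b})"
  proof
    fix x assume "x \<in> v ` {..<s}"
    then obtain i where i: "i < s" "x = v i" by auto
    have "v i = (\<Sum>k<b. smul (v i k) (e k))"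
      unfolding sume using wv i by (auto simp: fun_eq_iff)
    also have "\<dots> \<in> V.span (e ` {..<b})"
      by (intro V.span_sum V.span_scale V.span_base) auto
    finally show "x \<in> V.span (e ` {..<b})" using i by simp
  qed
  then have 1: "card (v ` {..<s}) \<le> card (e ` {..<b})"
    using V.independent_span_bound V.independent_family(2) [where s = s and v = v] indv by blast
  have "e ` {..<b} \<subseteq> V.span (v ` {..<s})"
  proof
    fix x assume "x \<in> e ` {..<b}"
    then obtain j where j: "j < b" "x = e j" by auto
    have "(\<lambda>k. const (e j k)) \<in> fm {} b"
      using j by (auto simp: fm_def e_def)
    then obtain c where c: "(\<lambda>k. const (e j k)) = (\<Sum>i<s. smul (const (c i)) (w i))"
      using w unfolding basis_mod_def by fastforce
    then have "e j = (\<Sum>i<s. smul (c i) (v i))"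
      unfolding sum_const fun_eq_iff by simp
    also have "\<dots> \<in> V.span (v ` {..<s})"
      by (intro V.span_sum V.span_scale V.span_base) auto
    finally show "x \<in> V.span (v ` {..<s})" using j by simp
  qed
  then have 2: "card (e ` {..<b}) \<le> card (v ` {..<s})"
    using V.independent_span_bound V.independent_family(2) [where s = b and v = e] inde by blast
  have "inj_on v {..<s}" "inj_on e {..<b}"
    using V.independent_family(1) indv inde by blast+
  then show ?thesis
    using 1 2 by (simp add: card_image)
qed

text \<open>Each step truncates the complex at F_1 before reducing it. So the index moves by one
  with each variable, and regularity comes from \<open>smul_var_in_im\<close>, whatever the resolved
  module is. When no variable is left, minimality makes all maps zero, exactness forces the modules
  after the initial one to vanish, and the socle is all of the initial one.\<close>

theorem last_rank:
  fixes A :: "nat \<Rightarrow> nat \<Rightarrow> nat \<Rightarrow> 'a::field mpoly"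
  assumes "finite U" and "acyclic_complex U b A"
    and "\<And>i k j. lookup (A i k j) 0 = 0"
    and "basis_mod s w (soc U (b 0) (im U b A 0)) (im U b A 0)"
  shows "b (card U) = s \<and> (\<forall>i > card U. b i = 0)"
  using assms
proof (induction U arbitrary: b A w rule: finite_induct)
  case empty
  have "A i k j = 0" for i k j
  proof -
    have "A i k j \<in> pset {}"
      using acyclic_complexD(1) [OF empty(1)] by (auto simp: fmats_def fm_def)
    then show ?thesis
      using pset_empty empty(2) by (metis const_0)
  qed
  then have L: "mat_app n (A i) v = 0" for n i v
    by (simp add: mat_app_def fun_eq_iff)
  have im: "im {} b A i = {0}" for i
    unfolding im_def L using fm_0 by blast
  have "b (Suc i) = 0" for i
  proof (rule ccontr)
    assume "b (Suc i) \<noteq> 0"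
    then have e: "(\<lambda>k. if k = 0 then 1 else 0) \<in> fm {} (b (Suc i))"
      by (auto simp: fm_def)
    have "(\<lambda>k::nat. if k = 0 then 1 else (0::'a mpoly)) = 0"
      using acyclic_complexD(3) [OF empty(1) e L] by (simp add: L)
    from fun_cong [OF this, of 0] show False
      by simp
  qed
  moreover have "soc {} (b 0) (im {} b A 0) = fm {} (b 0)"
    by (auto simp: soc_def)
  with empty(3) im have "s = b 0"
    using basis_mod_full by metis
  ultimately show ?case
    by (metis card.empty gr0_implies_Suc)
next
  case (insert x U)
  define b' where "b' i = b (Suc i)" for i
  define A' where "A' i = killm {x} (A (Suc i))" for i
  have U: "insert x U - {x} = U"
    using insert.hyps by auto
  have "acyclic_complex U b' A'"
    using acyclic_complex_kill [OF acyclic_complex_Suc [OF insert.prems(1)], of x]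
      smul_var_in_im [OF insert.prems(1), of _ x]
    by (simp add: U im_def b'_def [abs_def] A'_def [abs_def])
  moreover have "lookup (A' i k j) 0 = 0" for i k j
    by (simp add: A'_def killm_def kill_def lookup_restr insert.prems(2))
  moreover have "im (insert x U - {x}) b (\<lambda>i. killm {x} (A i)) 1 = im U b' A' 0"
    by (simp add: im_def b'_def A'_def U)
  then have "\<exists>w'. basis_mod s w' (soc U (b' 0) (im U b' A' 0)) (im U b' A' 0)"
    using basis_mod_soc_step [OF insert.prems(1) _ insert.prems(2,3), of x]
    by (simp add: b'_def U)
  ultimately have "b' (card U) = s \<and> (\<forall>i > card U. b' i = 0)"
    using insert.IH by blast
  moreover have "b i = b' (i - 1)" if "i > card U" for i
    using that by (simp add: b'_def)
  ultimately show ?case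
    using insert.hyps by auto
qed

section \<open>Noetherianity of graded submodules\<close>

lemma nat_seq_incseq_subseq:
  fixes a :: "nat \<Rightarrow> nat"
  shows "\<exists>r. strict_mono r \<and> incseq (\<lambda>i. a (r i))"
proof -
  obtain f :: "nat \<Rightarrow> nat" where f: "strict_mono f" "monoseq (\<lambda>n. a (f n))"
    using seq_monosub by blast
  show ?thesis
  proof (cases "incseq (\<lambda>n. a (f n))")
    case True
    with f show ?thesis by blast
  next
    case False
    then have dec: "decseq (\<lambda>n. a (f n))"
      using f(2) by (simp add: monoseq_iff)
    \<comment> \<open>A decreasing sequence of natural numbers is constant from the place of its
      least value on.\<close>
    obtain k where k: "\<And>n. a (f k) \<le> a (f n)"
      using ex_has_least_nat [of "\<lambda>_. True" 0 "\<lambda>n. a (f n)"] by auto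
    have "a (f (k + i)) = a (f k)" for i
      using dec k by (intro antisym) (auto simp: decseq_def)
    moreover have "strict_mono (\<lambda>i. f (k + i))"
      using f(1) by (simp add: strict_mono_def)
    ultimately show ?thesis
      by (intro exI [of _ "\<lambda>i. f (k + i)"]) (simp add: incseq_def)
  qed
qed

lemma incseq_subseq_coordinates:
  fixes f :: "nat \<Rightarrow> 'x \<Rightarrow>\<^sub>0 nat"
  assumes "finite U"
  shows "\<exists>r. strict_mono r \<and> (\<forall>x \<in> U. incseq (\<lambda>i. lookup (f (r i)) x))"
  using assms
proof induction
  case empty
  show ?case by (auto intro: exI [of _ id] simp: strict_mono_def)
next
  case (insert x U)
  then obtain r where r: "strict_mono r" "\<forall>x \<in> U. incseq (\<lambda>i. lookup (f (r i)) x)"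
    by blast
  obtain r' :: "nat \<Rightarrow> nat" where r': "strict_mono r'" "incseq (\<lambda>i. lookup (f (r (r' i))) x)"
    using nat_seq_incseq_subseq [of "\<lambda>i. lookup (f (r i)) x"] by blast
  have "incseq (\<lambda>i. lookup (f (r (r' i))) y)" if "y \<in> U" for y
    using r(2) that r'(1) unfolding incseq_def by (simp add: strict_mono_less_eq)
  moreover have "strict_mono (\<lambda>i. r (r' i))"
    using r(1) r'(1) by (simp add: strict_mono_def)
  ultimately show ?case
    using r'(2) by (intro exI [of _ "\<lambda>i. r (r' i)"]) auto
qed

lemma mon_degree_superset: "finite A \<Longrightarrow> keys t \<subseteq> A \<Longrightarrow> mon_degree t = (\<Sum>i \<in> A. lookup t i)"
  unfolding mon_degree_def by (intro sum.mono_neutral_left) (auto simp: in_keys_iff)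

lemma mon_degree_add: "mon_degree (s + t) = mon_degree s + mon_degree t"
  using mon_degree_superset [of "keys s \<union> keys t"]
  by (simp add: keys_plus_nat lookup_add sum.distrib)

lemma mon_degree_eq_0: "mon_degree t = 0 \<longleftrightarrow> t = 0"
  by (auto simp: mon_degree_def in_keys_iff simp flip: keys_eq_empty)

lemma mon_degree_0 [simp]: "mon_degree 0 = 0"
  by (simp add: mon_degree_eq_0)

lemma finite_monomials_of_degree: "finite U \<Longrightarrow> finite {t. keys t \<subseteq> U \<and> mon_degree t = d}"
proof -
  assume U: "finite U"
  have "lookup ` {t. keys t \<subseteq> U \<and> mon_degree t = d}
      \<subseteq> {f. \<forall>x. (x \<in> U \<longrightarrow> f x \<in> {..d}) \<and> (x \<notin> U \<longrightarrow> f x = 0)}"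
    using U by (auto simp: mon_degree_superset in_keys_iff intro: member_le_sum)
  then have "finite (lookup ` {t. keys t \<subseteq> U \<and> mon_degree t = d})"
    by (rule finite_subset) (rule finite_set_of_finite_funs [OF U finite_atMost])
  then show ?thesis
    by (rule finite_imageD) (simp add: inj_on_def flip: poly_mapping_eq_iff)
qed

text \<open>\<open>G\<close> consists of the elements that are minimal for divisibility. If it were
  infinite, it would contain a sequence that is nondecreasing in every coordinate, hence two
  distinct elements of which one divides the other.\<close>

lemma dickson:
  fixes L :: "(nat \<Rightarrow>\<^sub>0 nat) set"
  assumes "finite U" and L: "\<And>t. t \<in> L \<Longrightarrow> keys t \<subseteq> U"
  shows "\<exists>G \<subseteq> L. finite G \<and> (\<forall>t \<in> L. \<exists>s \<in> G. \<exists>u. t = s + u)"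
proof -
  define G where "G = {t \<in> L. \<forall>s \<in> L. (\<exists>u. t = s + u) \<longrightarrow> s = t}"
  have "\<exists>s \<in> G. \<exists>u. t = s + u" if "t \<in> L" for t
    using that
  proof (induction "mon_degree t" arbitrary: t rule: less_induct)
    case less
    show ?case
    proof (cases "t \<in> G")
      case True
      then show ?thesis by (intro bexI [of _ t] exI [of _ 0]) simp_all
    next
      case False
      then obtain s u where s: "s \<in> L" "t = s + u" "s \<noteq> t"
        using less.prems by (auto simp: G_def)
      then have "mon_degree s < mon_degree t"
        by (auto simp: mon_degree_add mon_degree_eq_0 neq0_conv [symmetric])
      with less.hyps s obtain s' u' where "s' \<in> G" "s = s' + u'"
        by blast
      with s show ?thesis by (auto simp: add.assoc)
    qed
  qed
  moreover have "finite G"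
  proof (rule ccontr)
    assume "infinite G"
    then obtain f :: "nat \<Rightarrow> nat \<Rightarrow>\<^sub>0 nat" where f: "inj f" "range f \<subseteq> G"
      using infinite_countable_subset by blast
    obtain r where r: "strict_mono r" "\<forall>x \<in> U. incseq (\<lambda>i. lookup (f (r i)) x)"
      using incseq_subseq_coordinates [OF assms(1)] by blast
    have le: "lookup (f (r 0)) x \<le> lookup (f (r 1)) x" for x
    proof (cases "x \<in> U")
      case True
      with r(2) show ?thesis unfolding incseq_def by blast
    next
      case False
      then have "x \<notin> keys (f (r 0))"
        using L f(2) unfolding G_def by blast
      then show ?thesis by (simp add: in_keys_iff)
    qed
    have "f (r 1) = f (r 0) + (f (r 1) - f (r 0))"
      by (intro poly_mapping_eqI) (simp add: lookup_add lookup_minus le [unfolded One_nat_def])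
    moreover have "f (r 0) \<in> G" "f (r 1) \<in> G"
      using f by auto
    ultimately have "f (r 0) = f (r 1)"
      unfolding G_def by blast
    then have "r 0 = r 1"
      using f(1) by (rule injD [rotated])
    then show False
      using strict_monoD [OF r(1), of 0 1] by simp
  qed
  moreover have "G \<subseteq> L"
    by (auto simp: G_def)
  ultimately show ?thesis
    by blast
qed

section \<open>Submodules, graded components and leading terms\<close>

definition submod :: "nat set \<Rightarrow> (nat \<Rightarrow> 'a::comm_ring_1 mpoly) set \<Rightarrow> bool" where
  "submod U Z \<longleftrightarrow> 0 \<in> Z \<and> (\<forall>v \<in> Z. \<forall>w \<in> Z. v + w \<in> Z) \<and> (\<forall>a \<in> pset U. \<forall>w \<in> Z. smul a w \<in> Z)"

text \<open>Meant for finite \<open>X\<close>: a sum over an infinite set is 0 by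
  convention.\<close>

definition poly_span :: "nat set \<Rightarrow> (nat \<Rightarrow> 'a::comm_ring_1 mpoly) set \<Rightarrow> (nat \<Rightarrow> 'a mpoly) set" where
  "poly_span U X = {\<Sum>g \<in> X. smul (a g) g | a. \<forall>g. a g \<in> pset U}"

lemma submodD:
  assumes "submod U Z"
  shows "0 \<in> Z" and "v \<in> Z \<Longrightarrow> w \<in> Z \<Longrightarrow> v + w \<in> Z" and "a \<in> pset U \<Longrightarrow> w \<in> Z \<Longrightarrow> smul a w \<in> Z"
    and "v \<in> Z \<Longrightarrow> w \<in> Z \<Longrightarrow> v - w \<in> Z"
proof -
  show *: "0 \<in> Z" "v \<in> Z \<Longrightarrow> w \<in> Z \<Longrightarrow> v + w \<in> Z" "a \<in> pset U \<Longrightarrow> w \<in> Z \<Longrightarrow> smul a w \<in> Z"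
    for v w a using assms unfolding submod_def by blast+
  assume vw: "v \<in> Z" "w \<in> Z"
  have "v + smul (- 1) w \<in> Z"
    by (intro *(2,3) vw pset_minus pset_1)
  then show "v - w \<in> Z"
    by (simp add: smul_minus_left)
qed

lemma submod_sum: "submod U Z \<Longrightarrow> (\<And>i. i \<in> I \<Longrightarrow> f i \<in> Z) \<Longrightarrow> sum f I \<in> Z"
  by (induction I rule: infinite_finite_induct)
    (simp_all only: sum.infinite sum.empty sum.insert submodD insertI1 insertI2 not_False_eq_True)

lemma submod_poly_span: "submod U (poly_span U X)"
  unfolding submod_def
proof (intro conjI ballI)
  show "0 \<in> poly_span U X"
    unfolding poly_span_def by (rule CollectI, rule exI [of _ "\<lambda>_. 0"]) (simp add: smul_def fun_eq_iff sum_fun_apply)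
  fix v assume "v \<in> poly_span U X"
  then obtain a where a: "\<forall>g. a g \<in> pset U" "v = (\<Sum>g \<in> X. smul (a g) g)"
    unfolding poly_span_def by blast
  {
    fix w assume "w \<in> poly_span U X"
    then obtain b where b: "\<forall>g. b g \<in> pset U" "w = (\<Sum>g \<in> X. smul (b g) g)"
      unfolding poly_span_def by blast
    have "v + w = (\<Sum>g \<in> X. smul (a g + b g) g)"
      unfolding a(2) b(2) sum.distrib [symmetric]
      by (intro sum.cong refl) (simp add: smul_def fun_eq_iff algebra_simps)
    with a(1) b(1) show "v + w \<in> poly_span U X"
      unfolding poly_span_def by (intro CollectI exI [of _ "\<lambda>g. a g + b g"]) (auto intro: pset_add)
  }
  fix c :: "'a mpoly" assume "c \<in> pset U"
  moreover have "smul c v = (\<Sum>g \<in> X. smul (c * a g) g)"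
    unfolding a(2) smul_sum by (simp add: smul_smul)
  ultimately show "smul c v \<in> poly_span U X"
    using a(1) unfolding poly_span_def by (intro CollectI exI [of _ "\<lambda>g. c * a g"]) (auto intro: pset_mult)
qed

lemma poly_span_subset: "submod U Z \<Longrightarrow> X \<subseteq> Z \<Longrightarrow> poly_span U X \<subseteq> Z"
  unfolding poly_span_def by (auto intro!: submod_sum submodD(3))

lemma poly_span_base: "finite X \<Longrightarrow> g \<in> X \<Longrightarrow> g \<in> poly_span U X"
  unfolding poly_span_def
proof (intro CollectI exI [of _ "\<lambda>h. if h = g then 1 else 0"] conjI allI)
  assume "finite X" "g \<in> X"
  have "(\<Sum>h \<in> X. smul (if h = g then 1 else 0) h) = (\<Sum>h \<in> X. if h = g then h else 0)"
    by (intro sum.cong refl) (auto simp: smul_def fun_eq_iff)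
  also have "\<dots> = g"
    using \<open>finite X\<close> \<open>g \<in> X\<close> by simp
  finally show "g = (\<Sum>h \<in> X. smul (if h = g then 1 else 0) h)" ..
qed auto

text \<open>Twists: the basis vector k has degree \<open>e k\<close>, so the coordinate k of a
  vector of degree \<open>D\<close> has degree \<open>D - e k\<close>.\<close>

definition hvec :: "(nat \<Rightarrow> int) \<Rightarrow> nat \<Rightarrow> int \<Rightarrow> (nat \<Rightarrow> 'a::comm_ring_1 mpoly) \<Rightarrow> bool" where
  "hvec e b D w \<longleftrightarrow> (\<forall>k<b. homogeneous (D - e k) (w k))"

definition hcomp :: "(nat \<Rightarrow> int) \<Rightarrow> int \<Rightarrow> (nat \<Rightarrow> 'a::comm_ring_1 mpoly) \<Rightarrow> nat \<Rightarrow> 'a mpoly" where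
  "hcomp e D w = (\<lambda>k. restr (\<lambda>t. int (mon_degree t) = D - e k) (w k))"

lemma hvec_hcomp: "hvec e b D (hcomp e D w)"
  by (simp add: hvec_def hcomp_def homogeneous_def keys_restr)

lemma sum_hcomp:
  assumes "w \<in> fm U b"
  shows "\<exists>I. w = (\<Sum>D \<in> I. hcomp e D w)"
proof (rule exI, rule ext, rule poly_mapping_eqI)
  let ?I = "\<Union>k<b. (\<lambda>t. int (mon_degree t) + e k) ` keys (w k)"
  fix k t
  have "lookup ((\<Sum>D \<in> ?I. hcomp e D w) k) t
      = (\<Sum>D \<in> ?I. if D = int (mon_degree t) + e k then lookup (w k) t else 0)"
    unfolding sum_fun_apply lookup_sum hcomp_def lookup_restr by (intro sum.cong refl) auto
  also have "\<dots> = (if int (mon_degree t) + e k \<in> ?I then lookup (w k) t else 0)"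
    by (subst sum.delta) auto
  also have "\<dots> = lookup (w k) t"
  proof (cases "t \<in> keys (w k)")
    case True
    then have "k < b"
      using assms by (auto simp: fm_def not_less [symmetric])
    with True show ?thesis by auto
  qed (simp add: in_keys_iff)
  finally show "lookup (w k) t = lookup ((\<Sum>D \<in> ?I. hcomp e D w) k) t" ..
qed

text \<open>Position over term: a vector with an earlier nonzero coordinate counts as larger, and at
  equal positions the monomials are compared by the linear order of \<open>poly_mapping\<close>. For
  the zero vector the value is arbitrary.\<close>

definition pos :: "(nat \<Rightarrow> 'a::comm_ring_1 mpoly) \<Rightarrow> nat" where
  "pos w = (LEAST k. w k \<noteq> 0)"

definition lt :: "(nat \<Rightarrow> 'a::comm_ring_1 mpoly) \<Rightarrow> nat \<Rightarrow>\<^sub>0 nat" where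
  "lt w = Max (keys (w (pos w)))"

lemma pos_nonzero: "w \<noteq> 0 \<Longrightarrow> w (pos w) \<noteq> 0"
  unfolding pos_def by (rule LeastI_ex) (auto simp: fun_eq_iff)

lemma pos_zero: "k < pos w \<Longrightarrow> w k = 0"
  unfolding pos_def using not_less_Least by blast

lemma pos_less: "w \<in> fm U b \<Longrightarrow> w \<noteq> 0 \<Longrightarrow> pos w < b"
  using pos_nonzero [of w] by (auto simp: fm_def not_less [symmetric])

lemma lt_in_keys: "w \<noteq> 0 \<Longrightarrow> lt w \<in> keys (w (pos w))"
  unfolding lt_def using pos_nonzero by (intro Max_in) auto

lemma lt_ge: "t \<in> keys (w (pos w)) \<Longrightarrow> t \<le> lt w"
  unfolding lt_def by (intro Max_ge) auto

text \<open>The multiplier cancels the leading coefficient, and the other monomials at this position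
  stay below because the order is compatible with products. A later position counts as
  smaller.\<close>

lemma lead_reduce:
  fixes w g :: "nat \<Rightarrow> 'a::field mpoly"
  assumes w: "w \<noteq> 0" and g: "g \<noteq> 0" "pos g = pos w" "lt w = lt g + u"
  defines "w' \<equiv> w - smul (Poly_Mapping.single u (lookup (w (pos w)) (lt w) / lookup (g (pos g)) (lt g))) g"
  assumes w': "w' \<noteq> 0"
  shows "pos w' > pos w \<or> pos w' = pos w \<and> lt w' < lt w"
proof -
  define c where "c = lookup (w (pos w)) (lt w) / lookup (g (pos g)) (lt g)"
  define k where "k = pos w"
  have w'_def: "w' j = w j - Poly_Mapping.single u c * g j" for j
    by (simp add: w'_def c_def smul_def)
  have "w' j = 0" if "j < k" for j
    using that g(2) pos_zero [of j w] pos_zero [of j g] by (simp add: w'_def k_def)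
  then have "k \<le> pos w'"
    using pos_nonzero [OF w'] by (meson not_le)
  moreover have "lt w' < lt w" if "pos w' = k"
  proof -
    have "lookup (w' k) (lt w) = lookup (w k) (lt w) - c * lookup (g k) (lt g)"
      using lookup_monomial_times [of u c "g k" "lt g"] g(3)
      by (simp add: w'_def lookup_minus add.commute)
    also have "\<dots> = 0"
      using lt_in_keys [OF g(1)] g(2) by (simp add: c_def k_def in_keys_iff)
    finally have "lt w' \<noteq> lt w"
      using lt_in_keys [OF w'] that by (auto simp: in_keys_iff)
    moreover have "lt w' \<in> keys (w k) \<union> keys (Poly_Mapping.single u c * g k)"
      using lt_in_keys [OF w'] keys_diff [of "w k" "Poly_Mapping.single u c * g k"] that
      by (auto simp: w'_def)
    moreover have "t \<le> lt w" if "t \<in> keys (w k)" for t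
      using lt_ge that by (auto simp: k_def)
    moreover have "t \<le> lt w" if t: "t \<in> keys (Poly_Mapping.single u c * g k)" for t
    proof -
      obtain s where s: "s \<in> keys (g k)" "t = u + s"
        using t keys_mult [of "Poly_Mapping.single u c" "g k"] by (auto split: if_splits)
      then have "s \<le> lt g"
        using lt_ge [of s g] g(2) by (simp add: k_def)
      then show ?thesis
        using s(2) g(3) add_right_mono [of s "lt g" u] by (simp add: add.commute)
    qed
    ultimately show ?thesis
      by (metis UnE order_less_le)
  qed
  ultimately show ?thesis
    unfolding k_def by linarith
qed

text \<open>\<open>X\<close> is a Groebner basis: for each of the finitely many positions Dickson's
  lemma yields finitely many leading monomials, each with a homogeneous representative. Homogeneity
  keeps a reduction inside one degree, and termination follows because that degree has only finitely
  many monomials.\<close>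

theorem noetherian_graded:
  fixes Z :: "(nat \<Rightarrow> 'a::field mpoly) set"
  assumes U: "finite U" and Z: "submod U Z" "Z \<subseteq> fm U b"
    and gr: "\<And>w D. w \<in> Z \<Longrightarrow> hcomp e D w \<in> Z"
  shows "\<exists>X \<subseteq> Z. finite X \<and> (\<forall>g \<in> X. \<exists>D. hvec e b D g) \<and> poly_span U X = Z"
proof -
  define H where "H = {w \<in> Z. w \<noteq> 0 \<and> (\<exists>D. hvec e b D w)}"
  define L where "L k = {lt w | w. w \<in> H \<and> pos w = k}" for k
  have keysU: "keys t \<subseteq> U" if "w \<in> Z" "t \<in> keys (w k)" for w t k
    using that Z(2) by (auto simp: fm_def pset_def subset_iff)
  have "\<exists>G \<subseteq> L k. finite G \<and> (\<forall>t \<in> L k. \<exists>s \<in> G. \<exists>u. t = s + u)" for k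
    by (rule dickson [OF U]) (use keysU lt_in_keys in \<open>auto simp: L_def H_def\<close>)
  then obtain G where G: "\<And>k. G k \<subseteq> L k" "\<And>k. finite (G k)"
    "\<And>k t. t \<in> L k \<Longrightarrow> \<exists>s \<in> G k. \<exists>u. t = s + u"
    by metis
  have "\<exists>w. w \<in> H \<and> pos w = k \<and> lt w = s" if "s \<in> G k" for k s
    using G(1) that by (auto simp: L_def)
  note ex_rp = this
  define rp where "rp k s = (SOME w. w \<in> H \<and> pos w = k \<and> lt w = s)" for k s
  have rp: "rp k s \<in> H \<and> pos (rp k s) = k \<and> lt (rp k s) = s" if "s \<in> G k" for k s
    unfolding rp_def using ex_rp [OF that] by (rule someI_ex)
  define X where "X = (\<Union>k<b. rp k ` G k)"
  have XH: "X \<subseteq> H"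
    using rp by (auto simp: X_def)
  then have XZ: "X \<subseteq> Z"
    by (auto simp: H_def)
  have finX: "finite X"
    using G(2) by (auto simp: X_def)
  have div: "\<exists>g \<in> X. pos g = pos w \<and> (\<exists>u. lt w = lt g + u)" if "w \<in> H" for w
  proof -
    have "pos w < b"
      using that Z(2) pos_less by (auto simp: H_def)
    moreover have "lt w \<in> L (pos w)"
      using that by (auto simp: L_def)
    then obtain s where "s \<in> G (pos w)" "\<exists>u. lt w = s + u"
      using G(3) by blast
    ultimately show ?thesis
      using rp [of s "pos w"] by (intro bexI [of _ "rp (pos w) s"]) (auto simp: X_def)
  qed
  have hom: "w \<in> poly_span U X" if "w \<in> Z" "hvec e b D w" for w D
  proof -
    \<comment> \<open>Termination measure: \<open>Bw w\<close> collects the pairs of a position and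
      a monomial of degree \<open>D\<close> that are not above the leading term of \<open>w\<close>.
      A negative \<open>D - e k\<close> becomes 0 under \<open>nat\<close>; this only adds the pair
      of k and the monomial 1, and \<open>B\<close> stays finite.\<close>
    define B where "B = (SIGMA k : {..<b}. {t. keys t \<subseteq> U \<and> mon_degree t = nat (D - e k)})"
    define Bw where "Bw w = {(k, t) \<in> B. pos w < k \<or> k = pos w \<and> t \<le> lt w}" for w :: "nat \<Rightarrow> 'a mpoly"
    have finB: "finite B"
      unfolding B_def using finite_monomials_of_degree [OF U] by (intro finite_SigmaI) auto
    show ?thesis
      using that
    proof (induction "card (Bw w)" arbitrary: w rule: less_induct)
      case less
      show ?case
      proof (cases "w = 0")
        case True
        then show ?thesis using submodD(1) [OF submod_poly_span] by blast
      next
        case False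
        then have "w \<in> H"
          using less.prems by (auto simp: H_def)
        then obtain g u where g: "g \<in> X" "pos g = pos w" "lt w = lt g + u"
          using div by blast
        then have gH: "g \<noteq> 0" "g \<in> Z"
          using XH by (auto simp: H_def)
        obtain D' where D': "hvec e b D' g"
          using XH g(1) by (auto simp: H_def)
        define p where "p = Poly_Mapping.single u (lookup (w (pos w)) (lt w) / lookup (g (pos g)) (lt g))"
        define w' where "w' = w - smul p g"
        have posb: "pos w < b"
          using False less.prems(1) Z(2) pos_less by auto
        have dw: "int (mon_degree (lt w)) = D - e (pos w)"
          using less.prems(2) lt_in_keys [OF False] posb by (auto simp: hvec_def homogeneous_def)
        have dg: "int (mon_degree (lt g)) = D' - e (pos w)"
          using D' lt_in_keys [OF gH(1)] posb g(2) by (auto simp: hvec_def homogeneous_def)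
        have du: "int (mon_degree u) = D - D'"
          using dw dg g(3) by (simp add: mon_degree_add)
        have "keys u \<subseteq> U"
          using keysU [OF less.prems(1) lt_in_keys [OF False]] g(3) by (simp add: keys_plus_nat)
        then have p: "p \<in> pset U"
          by (simp add: p_def pset_single)
        have w'Z: "w' \<in> Z"
          unfolding w'_def using less.prems(1) gH(2) p by (intro submodD [OF Z(1)])
        have hw': "hvec e b D w'"
          unfolding hvec_def homogeneous_def
        proof (intro allI impI ballI)
          fix k t assume k: "k < b" and t: "t \<in> keys (w' k)"
          have "t \<in> keys (w k) \<or> t \<in> keys (p * g k)"
            using t keys_diff [of "w k" "p * g k"] by (auto simp: w'_def smul_def)
          then show "int (mon_degree t) = D - e k"
          proof
            assume "t \<in> keys (w k)"
            with less.prems(2) k show ?thesis by (auto simp: hvec_def homogeneous_def)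
          next
            assume "t \<in> keys (p * g k)"
            then obtain s where s: "s \<in> keys (g k)" "t = u + s"
              using keys_mult [of p "g k"] by (auto simp: p_def split: if_splits)
            then have "int (mon_degree s) = D' - e k"
              using D' k by (auto simp: hvec_def homogeneous_def)
            with s du show ?thesis by (simp add: mon_degree_add)
          qed
        qed
        have "w' \<in> poly_span U X"
        proof (cases "w' = 0")
          case True
          then show ?thesis using submodD(1) [OF submod_poly_span] by metis
        next
          case w'0: False
          have less': "pos w' > pos w \<or> pos w' = pos w \<and> lt w' < lt w"
            using lead_reduce [OF False gH(1) g(2,3)] w'0 by (simp add: w'_def p_def)
          have "(pos w, lt w) \<in> B"
            using posb dw keysU [OF less.prems(1) lt_in_keys [OF False]] by (auto simp: B_def)
          then have "(pos w, lt w) \<in> Bw w"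
            by (simp add: Bw_def)
          moreover have "\<not> (pos w' < pos w \<or> pos w = pos w' \<and> lt w \<le> lt w')"
            using less' by (elim disjE conjE) (simp_all add: not_le)
          then have "(pos w, lt w) \<notin> Bw w'"
            by (simp add: Bw_def)
          moreover have "pos w < k \<or> k = pos w \<and> t \<le> lt w"
            if "pos w' < k \<or> k = pos w' \<and> t \<le> lt w'" for k t
            using less' that by (elim disjE conjE) simp_all
          then have "Bw w' \<subseteq> Bw w"
            unfolding Bw_def by blast
          moreover have "finite (Bw w)"
            by (rule finite_subset [OF _ finB]) (auto simp: Bw_def)
          ultimately have "card (Bw w') < card (Bw w)"
            by (intro psubset_card_mono) auto
          then show ?thesis
            using less.hyps w'Z hw' by blast
        qed
        moreover have "smul p g \<in> poly_span U X"
          using p g(1) finX by (intro submodD [OF submod_poly_span] poly_span_base)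
        ultimately have "w' + smul p g \<in> poly_span U X"
          by (rule submodD(2) [OF submod_poly_span])
        then show ?thesis
          by (simp add: w'_def)
      qed
    qed
  qed
  have "w \<in> poly_span U X" if w: "w \<in> Z" for w
  proof -
    obtain I where I: "w = (\<Sum>D \<in> I. hcomp e D w)"
      using sum_hcomp Z(2) w by blast
    have "(\<Sum>D \<in> I. hcomp e D w) \<in> poly_span U X"
      using gr [OF w] hvec_hcomp hom by (intro submod_sum [OF submod_poly_span]) blast
    with I show ?thesis by metis
  qed
  then have "poly_span U X = Z"
    using poly_span_subset [OF Z(1) XZ] by blast
  moreover have "\<forall>g \<in> X. \<exists>D. hvec e b D g"
    using XH by (auto simp: H_def)
  ultimately show ?thesis
    using XZ finX by blast
qed

section \<open>Minimal graded free resolutions\<close>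

text \<open>
  The last condition, that homogeneous syzygies have no constant terms, makes the next
  map of the resolution minimal. It holds when the columns of \<open>A\<close> generate \<open>Z\<close> irredundantly.
\<close>

definition presents ::
  "nat set \<Rightarrow> (nat \<Rightarrow> int) \<Rightarrow> nat \<Rightarrow> (nat \<Rightarrow> 'a::comm_ring_1 mpoly) set \<Rightarrow>
    (nat \<Rightarrow> int) \<Rightarrow> nat \<Rightarrow> (nat \<Rightarrow> nat \<Rightarrow> 'a mpoly) \<Rightarrow> bool" where
  "presents U e b Z e' r A \<longleftrightarrow>
     A \<in> fmats U b \<and>
     (\<forall>k<b. \<forall>j<r. homogeneous (e' j - e k) (A k j)) \<and>
     (\<forall>k. \<forall>j\<ge>r. A k j = 0) \<and>
     mat_app r A ` fm U r = Z \<and>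
     (\<forall>w D. w \<in> fm U r \<longrightarrow> mat_app r A w = 0 \<longrightarrow> hvec e' r D w \<longrightarrow> (\<forall>j. lookup (w j) 0 = 0))"

lemma homogeneous_unit:
  assumes "homogeneous D f" "lookup f 0 \<noteq> 0"
  shows "f = const (lookup f 0)"
proof -
  have "0 \<in> keys f"
    using assms(2) by (simp add: in_keys_iff)
  then have "D = 0"
    using assms(1) by (auto simp: homogeneous_def)
  then have "t = 0" if "t \<in> keys f" for t
    using assms(1) that by (auto simp: homogeneous_def mon_degree_eq_0)
  then show ?thesis
    by (intro poly_mapping_eqI) (auto simp: const_def lookup_single when_def in_keys_iff)
qed

text \<open>The generating set is chosen of least cardinality among the homogeneous ones; dropping a
  redundant element would give a smaller one.\<close>

lemma ex_irredundant_generators: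
  fixes Z :: "(nat \<Rightarrow> 'a::field mpoly) set"
  assumes U: "finite U" and Z: "submod U Z" "Z \<subseteq> fm U b"
    and gr: "\<And>w D. w \<in> Z \<Longrightarrow> hcomp e D w \<in> Z"
  shows "\<exists>X \<subseteq> Z. finite X \<and> (\<forall>g \<in> X. \<exists>D. hvec e b D g) \<and> poly_span U X = Z \<and>
    (\<forall>g \<in> X. g \<notin> poly_span U (X - {g}))"
proof -
  define P where "P X \<longleftrightarrow> X \<subseteq> Z \<and> finite X \<and> (\<forall>g \<in> X. \<exists>D. hvec e b D g) \<and> poly_span U X = Z" for X
  have "\<exists>X. P X"
    unfolding P_def by (rule noetherian_graded [OF U Z gr])
  then obtain X where X: "P X" and min: "\<And>Y. P Y \<Longrightarrow> card X \<le> card Y"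
    using ex_has_least_nat [of P _ card] by blast
  have "g \<notin> poly_span U (X - {g})" if g: "g \<in> X" for g
  proof
    assume *: "g \<in> poly_span U (X - {g})"
    have finX: "finite X"
      using X by (simp add: P_def)
    have "h \<in> poly_span U (X - {g})" if "h \<in> X" for h
      using * poly_span_base [of "X - {g}" h U] finX that by (cases "h = g") auto
    then have "poly_span U X \<subseteq> poly_span U (X - {g})"
      by (intro poly_span_subset [OF submod_poly_span]) blast
    moreover have "poly_span U (X - {g}) \<subseteq> Z"
      using X by (intro poly_span_subset [OF Z(1)]) (auto simp: P_def)
    ultimately have "P (X - {g})"
      using X by (auto simp: P_def)
    then have "card X \<le> card (X - {g})"
      by (rule min)
    then show False
      using card_Diff1_less [OF finX g] by simp
  qed
  with X show ?thesis
    unfolding P_def by blast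
qed

text \<open>The columns of \<open>A\<close> are irredundant homogeneous generators. In a homogeneous
  syzygy an entry with a constant term is a nonzero constant; inverting it would express its
  generator by the others.\<close>

lemma ex_presents:
  fixes Z :: "(nat \<Rightarrow> 'a::field mpoly) set"
  assumes U: "finite U" and Z: "submod U Z" "Z \<subseteq> fm U b"
    and gr: "\<And>w D. w \<in> Z \<Longrightarrow> hcomp e D w \<in> Z"
  shows "\<exists>e' r A. presents U e b Z e' r A"
proof -
  obtain X where X: "X \<subseteq> Z" "finite X" "\<And>g. g \<in> X \<Longrightarrow> \<exists>D. hvec e b D g" "poly_span U X = Z"
    "\<And>g. g \<in> X \<Longrightarrow> g \<notin> poly_span U (X - {g})"
    using ex_irredundant_generators [OF U Z gr] by blast
  define dg where "dg g = (SOME D. hvec e b D g)" for g :: "nat \<Rightarrow> 'a mpoly"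
  have dg: "hvec e b (dg g) g" if "g \<in> X" for g
    unfolding dg_def using X(3) [OF that] by (rule someI_ex)
  obtain xs where xs: "set xs = X" "distinct xs"
    using finite_distinct_list [OF X(2)] by blast
  define r where "r = length xs"
  define A where "A k j = (if j < r then (xs ! j) k else 0)" for k j
  have nth: "xs ! j \<in> X" if "j < r" for j
    using that xs(1) by (auto simp: r_def)
  have app: "mat_app r A w = (\<Sum>j<r. smul (w j) (xs ! j))" for w
    by (rule ext) (simp add: mat_app_def sum_fun_apply smul_def A_def mult.commute)
  have "mat_app r A w \<in> Z" if "w \<in> fm U r" for w
    unfolding app using that nth X(1)
    by (intro submod_sum [OF Z(1)] submodD(3) [OF Z(1)]) (auto simp: fm_def)
  moreover have "v \<in> mat_app r A ` fm U r" if "v \<in> Z" for v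
  proof -
    have "v \<in> poly_span U X"
      using that X(4) by simp
    then obtain a where a: "\<forall>g. a g \<in> pset U" "v = (\<Sum>g \<in> X. smul (a g) g)"
      unfolding poly_span_def by blast
    define w where "w j = (if j < r then a (xs ! j) else 0)" for j
    have "bij_betw ((!) xs) {..<r} X"
      using bij_betw_nth [OF xs(2), of "{..<r}" X] xs(1) by (simp add: r_def)
    then have "v = (\<Sum>j<r. smul (a (xs ! j)) (xs ! j))"
      unfolding a(2) by (rule sum.reindex_bij_betw [symmetric])
    also have "\<dots> = mat_app r A w"
      unfolding app by (intro sum.cong) (simp_all add: w_def)
    finally show ?thesis
      using a(1) by (intro image_eqI [of _ _ w]) (auto simp: fm_def w_def)
  qed
  ultimately have im: "mat_app r A ` fm U r = Z"
    by blast
  have min: "lookup (w j) 0 = 0"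
    if w: "w \<in> fm U r" "mat_app r A w = 0" "hvec (\<lambda>j. dg (xs ! j)) r D w" for w D j
  proof (rule ccontr)
    assume nz: "lookup (w j) 0 \<noteq> 0"
    then have j: "j < r"
      using w(1) by (auto simp: fm_def not_less [symmetric])
    define c where "c = lookup (w j) 0"
    have wj: "w j = const c"
      using w(3) j homogeneous_unit [OF _ nz] by (auto simp: c_def hvec_def)
    define v where "v = (\<Sum>i \<in> {..<r} - {j}. smul (w i) (xs ! i))"
    have "smul (const c) (xs ! j) + v = mat_app r A w"
      unfolding app v_def using j by (subst sum.remove [of _ j]) (auto simp: wj)
    then have v: "smul (const c) (xs ! j) + v = 0"
      using w(2) by simp
    have "smul (const (- inverse c)) v = smul (const (- inverse c)) (smul (const c) (xs ! j) + v) + xs ! j"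
      using nz by (simp add: smul_add smul_smul const_mult [symmetric] c_def const_minus smul_minus_left)
    also have "\<dots> = xs ! j"
      by (simp add: v)
    finally have "xs ! j = smul (const (- inverse c)) v" ..
    moreover have "xs ! i \<in> X - {xs ! j}" if "i \<in> {..<r} - {j}" for i
      using that nth j xs(2) by (auto simp: r_def nth_eq_iff_index_eq)
    then have "v \<in> poly_span U (X - {xs ! j})"
      unfolding v_def using w(1) X(2)
      by (intro submod_sum [OF submod_poly_span] submodD(3) [OF submod_poly_span] poly_span_base) (auto simp: fm_def)
    ultimately have "xs ! j \<in> poly_span U (X - {xs ! j})"
      using submodD(3) [OF submod_poly_span pset_const] by metis
    with X(5) [OF nth [OF j]] show False
      by contradiction
  qed
  have "A \<in> fmats U b"
    using nth X(1) Z(2) by (auto simp: fmats_def A_def fm_def subset_iff)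
  moreover have "homogeneous (dg (xs ! j) - e k) (A k j)" if "k < b" "j < r" for k j
    using dg [OF nth] that by (simp add: A_def hvec_def)
  ultimately have "presents U e b Z (\<lambda>j. dg (xs ! j)) r A"
    unfolding presents_def using im min by (auto simp: A_def)
  then show ?thesis by blast
qed

text \<open>A matrix that preserves degrees commutes with taking components. Therefore its kernel is
  graded, and generators can be chosen again.\<close>

lemma hcomp_mat_app:
  assumes "presents U e b Z e' r A" and w: "w \<in> fm U r"
  shows "mat_app r A (hcomp e' D w) = hcomp e D (mat_app r A w)"
proof
  fix k
  have A: "A \<in> fmats U b" "\<And>k j. k < b \<Longrightarrow> j < r \<Longrightarrow> homogeneous (e' j - e k) (A k j)"
    using assms(1) by (auto simp: presents_def)
  show "mat_app r A (hcomp e' D w) k = hcomp e D (mat_app r A w) k"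
  proof (cases "k < b")
    case True
    have "restr (\<lambda>t. int (mon_degree t) = D - e k) (A k j * w j)
        = A k j * restr (\<lambda>t. int (mon_degree t) = D - e' j) (w j)" if "j < r" for j
      using A(2) [OF True that] by (intro restr_mult_left) (auto simp: homogeneous_def mon_degree_add)
    then show ?thesis
      by (simp add: mat_app_def hcomp_def restr_sum)
  next
    case False
    then have "A k j = 0" for j
      using A(1) by (auto simp: fmats_def fm_def)
    then show ?thesis
      by (simp add: mat_app_def hcomp_def)
  qed
qed

definition ker :: "nat set \<Rightarrow> nat \<Rightarrow> (nat \<Rightarrow> nat \<Rightarrow> 'a::comm_ring_1 mpoly) \<Rightarrow> (nat \<Rightarrow> 'a mpoly) set" where
  "ker U r A = {w \<in> fm U r. mat_app r A w = 0}"

lemma submod_ker: "submod U (ker U r A)"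
  by (auto simp: submod_def ker_def mat_app_add mat_app_smul fm_smul)

lemma fm_hcomp: "w \<in> fm U r \<Longrightarrow> hcomp e D w \<in> fm U r"
  by (auto simp: fm_def hcomp_def pset_restr)

lemma graded_ker:
  assumes "presents U e b Z e' r A" "w \<in> ker U r A"
  shows "hcomp e' D w \<in> ker U r A"
  using assms fm_hcomp [of w U r e' D] hcomp_mat_app [OF assms(1), of w D]
  by (simp add: ker_def) (simp add: hcomp_def fun_eq_iff)

text \<open>A state of the dependent choice is a whole presentation, since the next one needs the
  matrix, for its kernel, and the twists and rank of its source. The clause for \<open>n = 0\<close>
  in \<open>P\<close> fixes the start.\<close>

lemma ex_presents_chain:
  fixes Z :: "(nat \<Rightarrow> 'a::field mpoly) set"
  assumes U: "finite U" and Z: "submod U Z" "Z \<subseteq> fm U b0"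
    and gr: "\<And>w D. w \<in> Z \<Longrightarrow> hcomp e0 D w \<in> Z"
  obtains E b A where "E 0 = e0" "b 0 = b0" "presents U (E 0) (b 0) Z (E 1) (b 1) (A 0)"
    "\<And>i. presents U (E (Suc i)) (b (Suc i)) (ker U (b (Suc i)) (A i))
        (E (Suc (Suc i))) (b (Suc (Suc i))) (A (Suc i))"
proof -
  define P where "P n x = (case x of (e, b, e', r, A) \<Rightarrow>
      (\<exists>Z. presents U e b Z e' r A) \<and> (n = 0 \<longrightarrow> e = e0 \<and> b = b0 \<and> presents U e b Z e' r A))"
    for n :: nat and x :: "(nat \<Rightarrow> int) \<times> nat \<times> (nat \<Rightarrow> int) \<times> nat \<times> (nat \<Rightarrow> nat \<Rightarrow> 'a mpoly)"
  define Q where "Q x y = (case x of (e, b, e', r, A) \<Rightarrow> case y of (f, c, f', s, B) \<Rightarrow>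
      f = e' \<and> c = r \<and> presents U e' r (ker U r A) f' s B)"
    for x y :: "(nat \<Rightarrow> int) \<times> nat \<times> (nat \<Rightarrow> int) \<times> nat \<times> (nat \<Rightarrow> nat \<Rightarrow> 'a mpoly)"
  have "\<exists>f. \<forall>n. P n (f n) \<and> Q (f n) (f (Suc n))"
  proof (rule dependent_nat_choice)
    obtain e' r A where "presents U e0 b0 Z e' r A"
      using ex_presents [OF U Z gr] by blast
    then show "\<exists>x. P 0 x"
      by (intro exI [of _ "(e0, b0, e', r, A)"]) (auto simp: P_def)
  next
    fix x n assume "P n x"
    obtain e b e' r A where x: "x = (e, b, e', r, A)"
      by (cases x) auto
    then obtain Y where Y: "presents U e b Y e' r A"
      using \<open>P n x\<close> by (auto simp: P_def)
    have "ker U r A \<subseteq> fm U r"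
      by (auto simp: ker_def)
    then obtain f' s B where "presents U e' r (ker U r A) f' s B"
      using ex_presents [OF U submod_ker _ graded_ker [OF Y]] by blast
    then show "\<exists>y. P (Suc n) y \<and> Q x y"
      by (intro exI [of _ "(e', r, f', s, B)"]) (auto simp: P_def Q_def x)
  qed
  then obtain f where f: "\<And>n. P n (f n)" "\<And>n. Q (f n) (f (Suc n))"
    by blast
  define E where "E n = fst (f n)" for n
  define b where "b n = fst (snd (f n))" for n
  define A where "A n = snd (snd (snd (snd (f n))))" for n
  have "E 0 = e0" "b 0 = b0" "presents U (E 0) (b 0) Z (E 1) (b 1) (A 0)"
    using f(1) [of 0] f(2) [of 0] by (auto simp: P_def Q_def E_def b_def A_def split: prod.splits)
  moreover have "presents U (E (Suc i)) (b (Suc i)) (ker U (b (Suc i)) (A i))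
        (E (Suc (Suc i))) (b (Suc (Suc i))) (A (Suc i))" for i
    using f(2) [of i] f(2) [of "Suc i"]
    by (auto simp: Q_def E_def b_def A_def split: prod.splits)
  ultimately show thesis
    using that by blast
qed

text \<open>The columns are the images of the basis vectors. Those of the next matrix are therefore
  homogeneous syzygies of the present one, to which the last clause of \<open>presents\<close>
  applies.\<close>

lemma presents_column:
  assumes "presents U e b Z e' r A" "j < r"
  shows "(\<lambda>k. A k j) \<in> Z" "hvec e b (e' j) (\<lambda>k. A k j)"
proof -
  have "mat_app r A (\<lambda>i. if i = j then 1 else 0) = (\<lambda>k. A k j)"
    using assms(2) by (simp add: mat_app_def if_distrib cong: if_cong)
  moreover have "(\<lambda>i. if i = j then 1 else 0) \<in> fm U r"
    using assms(2) by (auto simp: fm_def)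
  then have "mat_app r A (\<lambda>i. if i = j then 1 else 0) \<in> mat_app r A ` fm U r"
    by (rule imageI)
  moreover have "mat_app r A ` fm U r = Z"
    using assms(1) by (simp add: presents_def)
  ultimately show "(\<lambda>k. A k j) \<in> Z"
    by simp
  show "hvec e b (e' j) (\<lambda>k. A k j)"
    using assms by (auto simp: presents_def hvec_def)
qed

section \<open>Vectors and matrices as functions\<close>

definition vec_fun :: "'r::zero vec \<Rightarrow> nat \<Rightarrow> 'r" where
  "vec_fun w = (\<lambda>k. if k < dim_vec w then w $ k else 0)"

definition mat_fun :: "'r::zero mat \<Rightarrow> nat \<Rightarrow> nat \<Rightarrow> 'r" where
  "mat_fun M = (\<lambda>k j. if k < dim_row M \<and> j < dim_col M then M $$ (k, j) else 0)"

lemma inj_on_vf: "inj_on vec_fun (carrier_vec b)"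
proof (rule inj_onI)
  fix v w :: "'a vec" assume *: "v \<in> carrier_vec b" "w \<in> carrier_vec b" "vec_fun v = vec_fun w"
  show "v = w"
  proof (rule eq_vecI)
    fix i assume "i < dim_vec w"
    with fun_cong [OF *(3), of i] *(1,2) show "v $ i = w $ i"
      by (simp add: vec_fun_def)
  qed (use * in simp)
qed

lemma vec_fun_free_module: "vec_fun ` free_module N b = fm {1..N} b"
proof (intro equalityI subsetI)
  fix v assume "v \<in> vec_fun ` free_module N b"
  then show "v \<in> fm {1..N} b"
    by (auto simp: free_module_def fm_def vec_fun_def polys_eq_pset)
next
  fix v :: "nat \<Rightarrow> 'a mpoly" assume v: "v \<in> fm {1..N} b"
  then have "v = vec_fun (vec b v)"
    by (auto simp: vec_fun_def fm_def fun_eq_iff)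
  moreover have "vec b v \<in> free_module N b"
    using v by (auto simp: free_module_def fm_def polys_eq_pset)
  ultimately show "v \<in> vec_fun ` free_module N b"
    by blast
qed

lemma vec_fun_mult_mat_vec:
  assumes "M \<in> carrier_mat a b" "w \<in> carrier_vec b"
  shows "vec_fun (M *\<^sub>v w) = mat_app b (mat_fun M) (vec_fun w)"
proof
  fix k
  show "vec_fun (M *\<^sub>v w) k = mat_app b (mat_fun M) (vec_fun w) k"
    using assms by (auto simp: vec_fun_def mat_fun_def mat_app_def scalar_prod_def intro: sum.cong)
qed

context
  fixes N :: nat and I :: "'a::comm_ring_1 mpoly set" and e :: "nat \<Rightarrow> int list"
    and \<phi> :: "nat \<Rightarrow> 'a mpoly mat"
  assumes \<phi>: "\<And>i. \<phi> (Suc i) \<in> carrier_mat (length (e i)) (length (e (Suc i)))"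
begin

lemma vec_fun_boundaries:
  "vec_fun ` boundaries N e \<phi> i = im {1..N} (\<lambda>i. length (e i)) (\<lambda>i. mat_fun (\<phi> (Suc i))) i"
proof -
  have "vec_fun (\<phi> (Suc i) *\<^sub>v w) = mat_app (length (e (Suc i))) (mat_fun (\<phi> (Suc i))) (vec_fun w)"
    if "w \<in> free_module N (length (e (Suc i)))" for w
    using that by (intro vec_fun_mult_mat_vec [OF \<phi>]) (auto simp: free_module_def)
  then show ?thesis
    unfolding im_def boundaries_def vec_fun_free_module [symmetric] image_image by (intro image_cong) auto
qed

lemma vec_fun_cycles_Suc:
  "vec_fun ` cycles N I e \<phi> (Suc i) = ker {1..N} (length (e (Suc i))) (mat_fun (\<phi> (Suc i)))"
proof -
  have *: "w \<in> mat_kernel (\<phi> (Suc i)) \<longleftrightarrow> mat_app (length (e (Suc i))) (mat_fun (\<phi> (Suc i))) (vec_fun w) = 0"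
    if w: "w \<in> free_module N (length (e (Suc i)))" for w
  proof -
    have wc: "w \<in> carrier_vec (length (e (Suc i)))"
      using w by (auto simp: free_module_def)
    have z: "vec_fun (0\<^sub>v (length (e i))) = (0 :: nat \<Rightarrow> 'a mpoly)"
      by (auto simp: vec_fun_def fun_eq_iff)
    have "w \<in> mat_kernel (\<phi> (Suc i)) \<longleftrightarrow> \<phi> (Suc i) *\<^sub>v w = 0\<^sub>v (length (e i))"
      using wc \<phi> [of i] by (auto simp: mat_kernel_def)
    also have "\<dots> \<longleftrightarrow> vec_fun (\<phi> (Suc i) *\<^sub>v w) = vec_fun (0\<^sub>v (length (e i)))"
      using wc \<phi> [of i] by (intro inj_on_eq_iff [OF inj_on_vf [of "length (e i)"], symmetric]) auto
    finally show ?thesis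
      unfolding z vec_fun_mult_mat_vec [OF \<phi> wc] .
  qed
  have "cycles N I e \<phi> (Suc i) = {w \<in> free_module N (length (e (Suc i))). w \<in> mat_kernel (\<phi> (Suc i))}"
    by (auto simp: cycles_def)
  also have "\<dots> = {w \<in> free_module N (length (e (Suc i))).
      mat_app (length (e (Suc i))) (mat_fun (\<phi> (Suc i))) (vec_fun w) = 0}"
    using * by blast
  finally show ?thesis
    unfolding ker_def vec_fun_free_module [symmetric] by blast
qed

lemma vec_fun_cycles_0: "vec_fun ` cycles N I e \<phi> 0 = {w \<in> fm {1..N} 1. w 0 \<in> I}"
proof -
  have "vec_fun w 0 = w $ 0" if "w \<in> free_module N 1" for w :: "'a mpoly vec"
    using that by (auto simp: free_module_def vec_fun_def)
  then have "cycles N I e \<phi> 0 = {w \<in> free_module N 1. vec_fun w 0 \<in> I}"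
    unfolding cycles_def by (simp del: One_nat_def cong: conj_cong)
  then show ?thesis
    unfolding vec_fun_free_module [symmetric] by blast
qed

lemma cycles_subset: "e 0 = [0] \<Longrightarrow> cycles N I e \<phi> i \<subseteq> carrier_vec (length (e i))"
  by (cases i) (auto simp: cycles_def free_module_def)

lemma boundaries_subset: "boundaries N e \<phi> i \<subseteq> carrier_vec (length (e i))"
  using \<phi> [of i] by (auto simp: boundaries_def free_module_def)

lemma cycles_eq_boundaries_iff:
  assumes "e 0 = [0]"
  shows "cycles N I e \<phi> i = boundaries N e \<phi> i \<longleftrightarrow> vec_fun ` cycles N I e \<phi> i = vec_fun ` boundaries N e \<phi> i"
  using inj_on_image_eq_iff [OF inj_on_vf cycles_subset [OF assms] boundaries_subset] by metis

end

text \<open>The index drops by one, from \<open>\<phi> (Suc i)\<close> to \<open>A i\<close>.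
  Outside the matrix the entries of \<open>A i\<close> are 0, so that minimality holds for all k and
  j.\<close>

lemma resolution_acyclic_complex:
  assumes res: "minimal_graded_free_resolution N I e \<phi>"
  defines "b \<equiv> \<lambda>i. length (e i)" and "A \<equiv> \<lambda>i. mat_fun (\<phi> (Suc i))"
  shows "acyclic_complex {1..N} b A" and "im {1..N} b A 0 = {w \<in> fm {1..N} 1. w 0 \<in> I}"
    and "lookup (A i k j) 0 = 0" and "b 0 = 1"
proof -
  have e0: "e 0 = [0]"
    and \<phi>: "\<And>i. \<phi> (Suc i) \<in> carrier_mat (length (e i)) (length (e (Suc i)))"
    and entries: "\<And>i k j. k < length (e i) \<Longrightarrow> j < length (e (Suc i)) \<Longrightarrow>
      \<phi> (Suc i) $$ (k, j) \<in> polys N \<and> \<phi> (Suc i) $$ (k, j) \<in> irrelevant_ideal N"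
    and ex: "\<And>i. cycles N I e \<phi> i = boundaries N e \<phi> i"
    using res unfolding minimal_graded_free_resolution_def graded_free_resolution_def by blast+
  have "A i \<in> fmats {1..N} (b i)" for i
    using \<phi> [of i] entries [of _ i]
    by (auto simp: A_def b_def fmats_def fm_def mat_fun_def polys_eq_pset)
  moreover have "ker {1..N} (b (Suc i)) (A i) = im {1..N} b A (Suc i)" for i
    using vec_fun_cycles_Suc [where e = e and \<phi> = \<phi> and I = I, OF \<phi>, of N i]
      vec_fun_boundaries [where e = e and \<phi> = \<phi>, OF \<phi>, of N "Suc i"] ex [of "Suc i"]
    by (simp add: b_def A_def)
  ultimately show "acyclic_complex {1..N} b A"
    by (simp add: acyclic_complex_def ker_def)
  show "im {1..N} b A 0 = {w \<in> fm {1..N} 1. w 0 \<in> I}"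
    using vec_fun_cycles_0 [where e = e and \<phi> = \<phi> and I = I and N = N, OF \<phi>]
      vec_fun_boundaries [where e = e and \<phi> = \<phi>, OF \<phi>, of N 0] ex [of 0]
    by (simp add: b_def A_def)
  show "lookup (A i k j) 0 = 0"
    using \<phi> [of i] entries [of k i j] by (auto simp: A_def mat_fun_def irrelevant_ideal_def)
  show "b 0 = 1"
    by (simp add: b_def e0)
qed

text \<open>Finite length is not part of the claim; for the curve it follows from
  \<open>last_rank\<close>. The first map is minimal by \<open>proper\<close>, since its entries lie
  in \<open>I\<close>, and the later maps by the condition on syzygies in
  \<open>presents\<close>.\<close>

theorem ex_minimal_graded_free_resolution:
  fixes I :: "'a::field mpoly set"
  assumes Ip: "I \<subseteq> polys N" and I0: "0 \<in> I" and Iadd: "\<And>f g. f \<in> I \<Longrightarrow> g \<in> I \<Longrightarrow> f + g \<in> I"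
    and Imult: "\<And>a f. a \<in> polys N \<Longrightarrow> f \<in> I \<Longrightarrow> a * f \<in> I"
    and gr: "\<And>f D. f \<in> I \<Longrightarrow> restr (\<lambda>t. int (mon_degree t) = D) f \<in> I"
    and proper: "\<And>f. f \<in> I \<Longrightarrow> lookup f 0 = 0"
  shows "\<exists>e \<phi>. minimal_graded_free_resolution N I e \<phi>"
proof -
  let ?U = "{1..N}"
  define Z where "Z = {w \<in> fm ?U 1. w 0 \<in> I}"
  have Z: "submod ?U Z" "Z \<subseteq> fm ?U 1"
    using I0 Iadd Imult
    by (auto simp: submod_def Z_def fm_smul polys_eq_pset smul_def intro: fm_smul [unfolded smul_def])
  have grZ: "hcomp (\<lambda>_. 0) D w \<in> Z" if "w \<in> Z" for w D
    using that gr fm_hcomp [of w ?U 1 "\<lambda>_. 0" D] by (auto simp: Z_def hcomp_def)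
  obtain E b A where E: "E 0 = (\<lambda>_. 0)" and b: "b 0 = 1"
    and pr0: "presents ?U (E 0) (b 0) Z (E 1) (b 1) (A 0)"
    and pr: "\<And>i. presents ?U (E (Suc i)) (b (Suc i)) (ker ?U (b (Suc i)) (A i))
        (E (Suc (Suc i))) (b (Suc (Suc i))) (A (Suc i))"
    using ex_presents_chain [of ?U Z 1 "\<lambda>_. 0", OF _ Z grZ] by auto
  have pr': "\<exists>Y. presents ?U (E i) (b i) Y (E (Suc i)) (b (Suc i)) (A i)" for i
    using pr0 pr by (cases i) auto
  have A: "A i \<in> fmats ?U (b i)" "\<And>k j. k < b i \<Longrightarrow> j < b (Suc i) \<Longrightarrow> homogeneous (E (Suc i) j - E i k) (A i k j)"
    "\<And>k j. j \<ge> b (Suc i) \<Longrightarrow> A i k j = 0" for i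
    using pr' [of i] by (auto simp: presents_def)
  have im0: "im ?U b A 0 = Z" and imS: "im ?U b A (Suc i) = ker ?U (b (Suc i)) (A i)" for i
    using pr0 pr [of i] by (auto simp: presents_def im_def)
  have min: "lookup (A i k j) 0 = 0" if j: "j < b (Suc i)" for i k j
  proof (cases i)
    case 0
    have "(\<lambda>k. A 0 k j) \<in> Z"
      using presents_column(1) [OF pr0] j 0 by simp
    then show ?thesis
      using proper 0 by (cases k) (auto simp: Z_def fm_def)
  next
    case (Suc i')
    have "(\<lambda>k. A i k j) \<in> ker ?U (b i) (A i')" "hvec (E i) (b i) (E (Suc i) j) (\<lambda>k. A i k j)"
      using presents_column [OF pr [of i']] j Suc by auto
    then show ?thesis
      using pr' [of i'] Suc unfolding presents_def ker_def by blast
  qed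
  define e where "e i = map (E i) [0..<b i]" for i
  define \<phi> where "\<phi> i = mat (b (i - 1)) (b i) (\<lambda>(k, j). A (i - 1) k j)" for i
  have len: "length (e i) = b i" for i
    by (simp add: e_def)
  have \<phi>c: "\<phi> (Suc i) \<in> carrier_mat (length (e i)) (length (e (Suc i)))" for i
    by (simp add: \<phi>_def len)
  have \<phi>e: "\<phi> (Suc i) $$ (k, j) = A i k j" if "k < b i" "j < b (Suc i)" for i k j
    using that by (simp add: \<phi>_def)
  have mat_fun: "mat_fun (\<phi> (Suc i)) = A i" for i
    using A(1) [of i] A(3) [of i] by (auto simp: mat_fun_def \<phi>_def fmats_def fm_def fun_eq_iff not_less)
  have e0: "e 0 = [0]"
    by (simp add: e_def b E)
  have ex: "cycles N I e \<phi> i = boundaries N e \<phi> i" for i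
  proof -
    have "vec_fun ` cycles N I e \<phi> i = vec_fun ` boundaries N e \<phi> i"
    proof (cases i)
      case 0
      have "vec_fun ` cycles N I e \<phi> 0 = Z"
        using vec_fun_cycles_0 [where e = e and \<phi> = \<phi> and I = I and N = N, OF \<phi>c] by (simp add: Z_def)
      also have "\<dots> = vec_fun ` boundaries N e \<phi> 0"
        using vec_fun_boundaries [where e = e and \<phi> = \<phi>, OF \<phi>c, of N 0] im0 by (simp add: mat_fun len)
      finally show ?thesis
        by (simp add: 0)
    next
      case (Suc i')
      show ?thesis
        using vec_fun_cycles_Suc [where e = e and \<phi> = \<phi> and I = I, OF \<phi>c, of N i']
          vec_fun_boundaries [where e = e and \<phi> = \<phi>, OF \<phi>c, of N "Suc i'"] imS [of i']
        by (simp add: Suc mat_fun len)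
    qed
    then show ?thesis
      using cycles_eq_boundaries_iff [where e = e and \<phi> = \<phi> and I = I and N = N, OF \<phi>c e0] by blast
  qed
  have "A i k j \<in> polys N" for i k j
    using A(1) [of i] by (auto simp: polys_eq_pset fmats_def fm_def)
  then have "minimal_graded_free_resolution N I e \<phi>"
    unfolding minimal_graded_free_resolution_def graded_free_resolution_def
    using e0 \<phi>c ex A(2) min by (auto simp: len \<phi>e irrelevant_ideal_def) (auto simp: e_def)
  then show ?thesis by blast
qed

section \<open>Toric ideals\<close>

lemma mon_degree_single [simp]: "mon_degree (Poly_Mapping.single i k) = k"
  by (simp add: mon_degree_def)

text \<open>For the weights of a curve this is the exponent of u in the image of the
  monomial.\<close>

definition wt :: "(nat \<Rightarrow> nat) \<Rightarrow> (nat \<Rightarrow>\<^sub>0 nat) \<Rightarrow> nat" where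
  "wt a t = (\<Sum>i \<in> keys t. lookup t i * a i)"

lemma wt_superset: "finite A \<Longrightarrow> keys t \<subseteq> A \<Longrightarrow> wt a t = (\<Sum>i \<in> A. lookup t i * a i)"
  unfolding wt_def by (intro sum.mono_neutral_left) (auto simp: in_keys_iff)

lemma wt_add: "wt a (s + t) = wt a s + wt a t"
  using wt_superset [of "keys s \<union> keys t"]
  by (simp add: keys_plus_nat lookup_add sum.distrib algebra_simps)

lemma wt_single [simp]: "wt a (Poly_Mapping.single i k) = k * a i"
  by (simp add: wt_def)

lemma wt_0 [simp]: "wt a 0 = 0"
  by (simp add: wt_def)

definition total :: "('a \<Rightarrow>\<^sub>0 'b::comm_monoid_add) \<Rightarrow> 'b" where
  "total f = (\<Sum>t \<in> keys f. lookup f t)"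

lemma total_superset: "finite A \<Longrightarrow> keys f \<subseteq> A \<Longrightarrow> total f = (\<Sum>i \<in> A. lookup f i)"
  unfolding total_def by (intro sum.mono_neutral_left) (auto simp: in_keys_iff)

lemma total_0 [simp]: "total 0 = 0"
  by (simp add: total_def)

lemma total_single [simp]: "total (Poly_Mapping.single t c) = c"
  by (simp add: total_def)

lemma total_add: "total (f + g) = total f + total g"
  using keys_add [of f g]
  by (simp add: total_superset [of "keys f \<union> keys g"] lookup_add sum.distrib)

lemma total_sum: "total (\<Sum>i \<in> I. f i) = (\<Sum>i \<in> I. total (f i))"
  by (induction I rule: infinite_finite_induct) (simp_all add: total_add)

lemma total_monomial_mult: "total (Poly_Mapping.single s c * f) = c * total f"
  for f :: "'a::monoid_add \<Rightarrow>\<^sub>0 'b::semiring_0"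
proof -
  have "total (Poly_Mapping.single s c * f)
      = total (Poly_Mapping.single s c * (\<Sum>t \<in> keys f. Poly_Mapping.single t (lookup f t)))"
    by (simp add: sum_single_lookup)
  also have "\<dots> = c * total f"
    by (simp add: sum_distrib_left mult_single total_sum) (simp add: total_def sum_distrib_left)
  finally show ?thesis .
qed

text \<open>The bidegree of a monomial consists of its weight \<open>p\<close> and its degree
  \<open>q\<close>. For a curve, the value is the coefficient of u^p v^(q m_n - p) in the image of
  \<open>f\<close>.\<close>

definition fibre_sum :: "(nat \<Rightarrow> nat) \<Rightarrow> nat \<Rightarrow> nat \<Rightarrow> 'a::comm_ring_1 mpoly \<Rightarrow> 'a" where
  "fibre_sum a p q f = total (restr (\<lambda>t. wt a t = p \<and> mon_degree t = q) f)"

lemma fibre_sum_0 [simp]: "fibre_sum a p q 0 = 0"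
  and fibre_sum_add: "fibre_sum a p q (f + g) = fibre_sum a p q f + fibre_sum a p q g"
  and fibre_sum_sum: "fibre_sum a p q (\<Sum>i \<in> I. h i) = (\<Sum>i \<in> I. fibre_sum a p q (h i))"
  by (simp_all add: fibre_sum_def restr_add restr_sum total_add total_sum)

lemma fibre_sum_single: "fibre_sum a p q (Poly_Mapping.single t c) = (if wt a t = p \<and> mon_degree t = q then c else 0)"
  by (simp add: fibre_sum_def restr_single)

lemma fibre_sum_diff: "fibre_sum a p q (f - g) = fibre_sum a p q f - fibre_sum a p q g"
  using fibre_sum_add [of a p q "f - g" g] by simp

lemma fibre_sum_mult_monomial:
  "fibre_sum a (wt a u + p) (mon_degree u + q) (Poly_Mapping.single u c * f) = c * fibre_sum a p q f"
proof -
  have "restr (\<lambda>t. wt a t = wt a u + p \<and> mon_degree t = mon_degree u + q) (Poly_Mapping.single u c * f)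
      = Poly_Mapping.single u c * restr (\<lambda>t. wt a t = p \<and> mon_degree t = q) f"
    by (rule restr_mult_left) (auto simp: wt_add mon_degree_add split: if_splits)
  then show ?thesis
    by (simp add: fibre_sum_def total_monomial_mult)
qed

lemma fibre_sum_mult_var: "fibre_sum a (p + a i) (Suc q) (var i * f) = fibre_sum a p q f"
  using fibre_sum_mult_monomial [of a "Poly_Mapping.single i 1" p q 1 f] by (simp add: var_def add.commute)

lemma fibre_sum_mult_const: "fibre_sum a p q (const c * f) = c * fibre_sum a p q f"
  using fibre_sum_mult_monomial [of a 0 p q c f] by (simp add: const_def)

lemma fibre_sum_eq_0: "(\<And>t. t \<in> keys f \<Longrightarrow> wt a t = p \<Longrightarrow> mon_degree t \<noteq> q) \<Longrightarrow> fibre_sum a p q f = 0"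
  unfolding fibre_sum_def by (subst restr_eq_0) auto

lemma fibre_sum_nonzero: "fibre_sum a p q f \<noteq> 0 \<Longrightarrow> \<exists>t \<in> keys f. wt a t = p \<and> mon_degree t = q"
  using fibre_sum_eq_0 by blast

text \<open>The ideal is given by linear equations, one for each bidegree, instead of
  generators.\<close>

definition toric :: "(nat \<Rightarrow> nat) \<Rightarrow> nat set \<Rightarrow> 'a::comm_ring_1 mpoly set" where
  "toric a W = {f \<in> pset W. \<forall>p q. fibre_sum a p q f = 0}"

lemma toric_mult:
  assumes g: "g \<in> pset W" and f: "f \<in> toric a W"
  shows "g * f \<in> toric a W"
proof -
  have "fibre_sum a p q (Poly_Mapping.single u c * f) = 0" for p q u c
  proof (cases "\<exists>p' q'. p = wt a u + p' \<and> q = mon_degree u + q'")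
    case True
    then show ?thesis
      using f by (auto simp: fibre_sum_mult_monomial toric_def)
  next
    case False
    show ?thesis
    proof (rule fibre_sum_eq_0)
      fix t assume "t \<in> keys (Poly_Mapping.single u c * f)" "wt a t = p"
      then obtain s where "t = u + s"
        using keys_mult [of "Poly_Mapping.single u c" f] by (auto split: if_splits)
      with False \<open>wt a t = p\<close> show "mon_degree t \<noteq> q"
        by (auto simp: wt_add mon_degree_add)
    qed
  qed
  then have "fibre_sum a p q ((\<Sum>u \<in> keys g. Poly_Mapping.single u (lookup g u)) * f) = 0" for p q
    by (simp add: sum_distrib_right fibre_sum_sum)
  then show ?thesis
    using g f by (auto simp: toric_def sum_single_lookup)
qed

text \<open>
  A polynomial without the variables in \<open>V\<close> lies in the image of the toric ideal under \<open>kill V\<close>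
  as soon as it satisfies the equations for the weights and degrees that are not bad: in a bad
  one, a monomial that is killed can be used to correct the sum of the coefficients.
\<close>

definition bad :: "(nat \<Rightarrow> nat) \<Rightarrow> nat set \<Rightarrow> nat set \<Rightarrow> nat \<Rightarrow> nat \<Rightarrow> bool" where
  "bad a W V p q \<longleftrightarrow> (\<exists>t. keys t \<subseteq> W \<and> keys t \<inter> V \<noteq> {} \<and> wt a t = p \<and> mon_degree t = q)"

lemma kill_toric:
  "kill V ` toric a W = {f \<in> pset (W - V). \<forall>p q. \<not> bad a W V p q \<longrightarrow> fibre_sum a p q f = 0}"
proof (intro equalityI subsetI)
  fix f assume "f \<in> kill V ` toric a W"
  then obtain h where h: "h \<in> toric a W" "f = kill V h"
    by blast
  have "fibre_sum a p q f = 0" if "\<not> bad a W V p q" for p q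
  proof -
    have "restr (\<lambda>t. wt a t = p \<and> mon_degree t = q) (kill V h) = restr (\<lambda>t. wt a t = p \<and> mon_degree t = q) h"
    proof (rule poly_mapping_eqI)
      fix t
      show "lookup (restr (\<lambda>t. wt a t = p \<and> mon_degree t = q) (kill V h)) t
          = lookup (restr (\<lambda>t. wt a t = p \<and> mon_degree t = q) h) t"
      proof (cases "t \<in> keys h \<and> wt a t = p \<and> mon_degree t = q")
        case True
        then have "keys t \<inter> V = {}"
          using that h(1) unfolding bad_def toric_def pset_def by blast
        then show ?thesis by (simp add: lookup_restr kill_def)
      qed (auto simp: lookup_restr kill_def in_keys_iff)
    qed
    then have "fibre_sum a p q f = fibre_sum a p q h"
      by (simp add: fibre_sum_def h(2))
    with h(1) show ?thesis by (simp add: toric_def)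
  qed
  with h show "f \<in> {f \<in> pset (W - V). \<forall>p q. \<not> bad a W V p q \<longrightarrow> fibre_sum a p q f = 0}"
    by (auto simp: toric_def kill_pset)
next
  fix f :: "'a mpoly"
  assume "f \<in> {f \<in> pset (W - V). \<forall>p q. \<not> bad a W V p q \<longrightarrow> fibre_sum a p q f = 0}"
  then have f: "f \<in> pset (W - V)" "\<And>p q. \<not> bad a W V p q \<Longrightarrow> fibre_sum a p q f = 0"
    by auto
  \<comment> \<open>In a bad bidegree \<open>T p q\<close> is a monomial that \<open>kill V\<close>
    removes. Subtracting it with the coefficient of each term of \<open>f\<close> in that bidegree
    makes the sum zero without changing the image under \<open>kill V\<close>.\<close>
  define T where "T p q = (SOME t. keys t \<subseteq> W \<and> keys t \<inter> V \<noteq> {} \<and> wt a t = p \<and> mon_degree t = q)" for p q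
  have T: "keys (T p q) \<subseteq> W" "keys (T p q) \<inter> V \<noteq> {}" "wt a (T p q) = p" "mon_degree (T p q) = q"
    if "bad a W V p q" for p q
    using someI_ex [OF that [unfolded bad_def]] unfolding T_def by blast+
  define g where "g t = (if bad a W V (wt a t) (mon_degree t)
      then Poly_Mapping.single (T (wt a t) (mon_degree t)) (lookup f t) else 0)" for t
  define h where "h = f - (\<Sum>t \<in> keys f. g t)"
  have "g t \<in> pset W" for t
    using T by (auto simp: g_def intro: pset_single)
  then have "h \<in> pset W"
    unfolding h_def using f(1) by (intro pset_diff pset_sum) (auto intro: pset_mono)
  moreover have "fibre_sum a p q h = 0" for p q
  proof (cases "bad a W V p q")
    case True
    have "fibre_sum a p q f = fibre_sum a p q (\<Sum>t \<in> keys f. Poly_Mapping.single t (lookup f t))"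
      by (simp add: sum_single_lookup)
    also have "\<dots> = fibre_sum a p q (\<Sum>t \<in> keys f. g t)"
      unfolding fibre_sum_sum
    proof (intro sum.cong refl)
      fix t
      show "fibre_sum a p q (Poly_Mapping.single t (lookup f t)) = fibre_sum a p q (g t)"
        using True T by (auto simp: g_def fibre_sum_single)
    qed
    finally show ?thesis
      by (simp add: h_def fibre_sum_diff)
  next
    case False
    then have "fibre_sum a p q (g t) = 0" for t
      using T by (auto simp: g_def fibre_sum_single)
    then show ?thesis
      using f(2) [OF False] by (simp add: h_def fibre_sum_diff fibre_sum_sum)
  qed
  ultimately have "h \<in> toric a W"
    by (simp add: toric_def)
  moreover have "kill V (g t) = 0" for t
    using T by (auto simp: g_def kill_def restr_single)
  then have "kill V (f - h) = 0"
    by (simp add: h_def kill_sum)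
  then have "kill V h = f"
    using kill_add [of V "f - h" h] kill_id [OF f(1), of V] by auto
  ultimately show "f \<in> kill V ` toric a W"
    by blast
qed

lemma bad_singleton:
  assumes "x \<in> W"
  shows "bad a W {x} p q \<longleftrightarrow>
    (\<exists>t. keys t \<subseteq> W \<and> p = wt a t + a x \<and> q = Suc (mon_degree t))"
proof
  assume "bad a W {x} p q"
  then obtain t where t: "keys t \<subseteq> W" "x \<in> keys t" "wt a t = p" "mon_degree t = q"
    by (auto simp: bad_def)
  define s where "s = t - Poly_Mapping.single x 1"
  have "t = s + Poly_Mapping.single x 1"
    using t(2) unfolding s_def
    by (intro poly_mapping_eqI) (auto simp: lookup_add lookup_minus lookup_single when_def in_keys_iff)
  then show "\<exists>t. keys t \<subseteq> W \<and> p = wt a t + a x \<and> q = Suc (mon_degree t)"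
    using t by (intro exI [of _ s]) (auto simp: wt_add mon_degree_add keys_plus_nat)
next
  assume "\<exists>t. keys t \<subseteq> W \<and> p = wt a t + a x \<and> q = Suc (mon_degree t)"
  then obtain t where "keys t \<subseteq> W" "p = wt a t + a x" "q = Suc (mon_degree t)"
    by blast
  then show "bad a W {x} p q"
    unfolding bad_def using assms
    by (intro exI [of _ "t + Poly_Mapping.single x 1"]) (auto simp: wt_add mon_degree_add keys_plus_nat)
qed

subsection \<open>Projective monomial curves\<close>

definition curve_weight :: "nat \<Rightarrow> (nat \<Rightarrow> nat) \<Rightarrow> nat \<Rightarrow> nat" where
  "curve_weight n m i = (if i \<le> n then m i else 0)"

definition uv :: "nat \<Rightarrow> nat \<Rightarrow> nat \<Rightarrow>\<^sub>0 nat" where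
  "uv p r = Poly_Mapping.single 1 p + Poly_Mapping.single 2 r"

lemma uv_add: "uv p r + uv p' r' = uv (p + p') (r + r')"
  by (simp add: uv_def single_add ac_simps)

lemma uv_inject [simp]: "uv p r = uv p' r' \<longleftrightarrow> p = p' \<and> r = r'"
proof
  assume *: "uv p r = uv p' r'"
  have "lookup (uv p r) 1 = p" "lookup (uv p r) 2 = r" for p r
    by (simp_all add: uv_def lookup_add lookup_single)
  with * show "p = p' \<and> r = r'" by metis
qed simp

lemma var_power: "var i ^ k = Poly_Mapping.single (Poly_Mapping.single i k) 1"
  by (induction k) (simp_all add: var_def mult_single flip: single_add)

lemma uv_power: "Poly_Mapping.single (uv p r) 1 ^ k
    = (Poly_Mapping.single (uv (k * p) (k * r)) 1 :: 'a::comm_ring_1 mpoly)"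
  by (induction k) (simp_all add: mult_single uv_add, simp add: uv_def)

lemma curve_param_eq:
  "curve_param n m i = Poly_Mapping.single (uv (curve_weight n m i) (m n - curve_weight n m i)) 1"
  by (simp add: curve_param_def curve_weight_def var_power mult_single uv_def)

lemma prod_uv: "(\<Prod>i \<in> I. Poly_Mapping.single (uv (f i) (g i)) 1)
    = (Poly_Mapping.single (uv (sum f I) (sum g I)) 1 :: 'a::comm_ring_1 mpoly)"
  by (induction I rule: infinite_finite_induct) (simp_all add: mult_single uv_add, simp_all add: uv_def)

lemma subst_curve_param:
  "subst (curve_param n m) f = (\<Sum>t \<in> keys f. Poly_Mapping.single
     (uv (wt (curve_weight n m) t) (wt (\<lambda>i. m n - curve_weight n m i) t)) (lookup f t))"
  unfolding subst_def
  by (intro sum.cong refl)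
    (simp add: curve_param_eq uv_power prod_uv const_def mult_single flip: wt_def)

text \<open>A monomial of weight p and degree q maps to u^p v^(q m_n - p). As m_n > 0, the two
  exponents determine q, so monomials have the same image iff they have the same bidegree.\<close>

lemma vanishing_ideal_eq_toric:
  assumes m: "\<And>i. i \<in> {1..n} \<Longrightarrow> m i \<le> m n" and pos: "m n > 0"
  shows "vanishing_ideal n m = toric (curve_weight n m) {1..n + 1}"
proof -
  define a where "a = curve_weight n m"
  define a' where "a' i = m n - a i" for i
  have deg: "wt a t + wt a' t = mon_degree t * m n" if "keys t \<subseteq> {1..n + 1}" for t
  proof -
    have "lookup t i * a i + lookup t i * a' i = lookup t i * m n" if "i \<in> {1..n + 1}" for i
      using m [of i] that by (auto simp: a'_def a_def curve_weight_def simp flip: add_mult_distrib2)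
    then have "(\<Sum>i \<in> {1..n + 1}. lookup t i * a i + lookup t i * a' i)
        = (\<Sum>i \<in> {1..n + 1}. lookup t i * m n)"
      by (rule sum.cong [OF refl])
    then show ?thesis
      unfolding wt_superset [OF finite_atLeastAtMost that] mon_degree_superset [OF finite_atLeastAtMost that]
        sum.distrib sum_distrib_right .
  qed
  have "subst (curve_param n m) f = 0 \<longleftrightarrow> (\<forall>p q. fibre_sum a p q f = 0)" if f: "f \<in> polys (n + 1)"
    for f :: "'a mpoly"
  proof -
    have keys: "keys t \<subseteq> {1..n + 1}" if "t \<in> keys f" for t
      using f that by (auto simp: polys_def)
    have same: "wt a s = wt a t \<and> wt a' s = wt a' t \<longleftrightarrow> wt a s = wt a t \<and> mon_degree s = mon_degree t"
      if "s \<in> keys f" "t \<in> keys f" for s t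
      using deg [OF keys [OF that(1)]] deg [OF keys [OF that(2)]] pos by auto
    have subst: "subst (curve_param n m) f
        = (\<Sum>s \<in> keys f. Poly_Mapping.single (uv (wt a s) (wt a' s)) (lookup f s))"
      unfolding subst_curve_param a'_def a_def ..
    have fibre_sum: "fibre_sum a p q f = (\<Sum>s \<in> keys f. if wt a s = p \<and> mon_degree s = q then lookup f s else 0)" for p q
      by (subst sum_single_lookup [of f, symmetric], unfold fibre_sum_sum fibre_sum_single) simp
    have eq: "lookup (subst (curve_param n m) f) (uv (wt a t) (wt a' t)) = fibre_sum a (wt a t) (mon_degree t) f"
      if "t \<in> keys f" for t
      unfolding subst fibre_sum lookup_sum lookup_single when_def using same [OF _ that]
      by (intro sum.cong refl) auto
    show ?thesis
    proof
      assume 0: "subst (curve_param n m) f = 0"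
      show "\<forall>p q. fibre_sum a p q f = 0"
        using eq 0 fibre_sum_nonzero [of a _ _ f] by (metis lookup_zero)
    next
      assume 0: "\<forall>p q. fibre_sum a p q f = 0"
      show "subst (curve_param n m) f = 0"
      proof (rule poly_mapping_eqI, unfold lookup_zero)
        fix k
        show "lookup (subst (curve_param n m) f) k = 0"
        proof (cases "\<exists>t \<in> keys f. k = uv (wt a t) (wt a' t)")
          case True
          then show ?thesis using eq 0 by auto
        next
          case False
          then show ?thesis
            unfolding subst lookup_sum lookup_single when_def by (intro sum.neutral) auto
        qed
      qed
    qed
  qed
  then show ?thesis
    unfolding vanishing_ideal_def toric_def a_def polys_eq_pset by blast
qed

section \<open>Curves defined by arithmetic sequences\<close>

locale arithmetic_curve =
  fixes n d \<tau> :: nat and m :: "nat \<Rightarrow> nat" and c :: int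
  assumes n2: "n \<ge> 2"
    and m1_pos: "m 1 > 0" and d_pos: "d > 0"
    and m_eq: "\<forall>i \<in> {1..n}. m i = m 1 + (i - 1) * d"
    and coprime_m1_d: "gcd (m 1) d = 1"
    and \<tau>: "\<tau> \<in> {1..n - 1}"
    and m1_eq: "int (m 1) - 1 = c * (int n - 1) + int \<tau>"
begin

section \<open>The semigroup of bidegrees of the curve\<close>

abbreviation a :: "nat \<Rightarrow> nat" where "a \<equiv> curve_weight n m"

abbreviation W :: "nat set" where "W \<equiv> {1..n + 1}"

lemma a_eq: "1 \<le> i \<Longrightarrow> i \<le> n \<Longrightarrow> a i = m 1 + (i - 1) * d"
  and a_Suc_n: "a (Suc n) = 0"
  and a_n: "a n = m 1 + (n - 1) * d"
  using m_eq [rule_format, of i] m_eq [rule_format, of n] n2 by (auto simp: curve_weight_def)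

text \<open>A factor x_i contributes m_1 + (i - 1) d to the weight. So \<open>s\<close> is the sum
  of i - 1 over all factors, each being at most n - 1.\<close>

lemma wt_form:
  assumes "keys t \<subseteq> {1..n}"
  shows "\<exists>s \<le> mon_degree t * (n - 1). wt a t = mon_degree t * m 1 + s * d"
proof -
  have deg: "mon_degree t = (\<Sum>i \<in> {1..n}. lookup t i)"
    using assms by (intro mon_degree_superset) auto
  have "wt a t = (\<Sum>i \<in> {1..n}. lookup t i * a i)"
    using assms by (intro wt_superset) auto
  also have "\<dots> = (\<Sum>i \<in> {1..n}. lookup t i * m 1 + lookup t i * (i - 1) * d)"
    by (intro sum.cong refl) (auto simp: a_eq algebra_simps)
  also have "\<dots> = mon_degree t * m 1 + (\<Sum>i \<in> {1..n}. lookup t i * (i - 1)) * d"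
    by (simp only: sum.distrib deg sum_distrib_right)
  finally have "wt a t = mon_degree t * m 1 + (\<Sum>i \<in> {1..n}. lookup t i * (i - 1)) * d" .
  moreover have "(\<Sum>i \<in> {1..n}. lookup t i * (i - 1)) \<le> mon_degree t * (n - 1)"
    unfolding deg sum_distrib_right by (intro sum_mono mult_left_mono) auto
  ultimately show ?thesis by blast
qed

text \<open>Greedy choice: the next factor takes as much of the index sum \<open>s\<close> as one
  variable can carry, that is \<open>min s (n - 1)\<close>.\<close>

lemma ex_monomial:
  assumes "s \<le> r * (n - 1)"
  shows "\<exists>t. keys t \<subseteq> {1..n} \<and> mon_degree t = r \<and> wt a t = r * m 1 + s * d"
  using assms
proof (induction r arbitrary: s)
  case 0
  then show ?case by (intro exI [of _ 0]) auto
next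
  case (Suc r)
  define i where "i = min s (n - 1)"
  have "s - i \<le> r * (n - 1)"
    using Suc.prems by (auto simp: i_def)
  then obtain t where t: "keys t \<subseteq> {1..n}" "mon_degree t = r" "wt a t = r * m 1 + (s - i) * d"
    using Suc.IH by blast
  have "Suc i \<le> n"
    using n2 by (auto simp: i_def)
  moreover from this have "a (Suc i) = m 1 + i * d"
    using a_eq [of "Suc i"] by simp
  moreover have "i \<le> s"
    by (simp add: i_def)
  then have "(s - i) * d + i * d = s * d"
    by (simp flip: add_mult_distrib)
  ultimately show ?case
    using t by (intro exI [of _ "t + Poly_Mapping.single (Suc i) 1"])
      (auto simp: keys_plus_nat mon_degree_add wt_add)
qed

text \<open>These are the bidegrees of the monomials in x_1, ..., x_(n+1): r counts the factors
  other than x_(n+1), which has weight 0 and fills the degree up to q.\<close>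

definition S :: "nat \<Rightarrow> nat \<Rightarrow> bool" where
  "S p q \<longleftrightarrow> (\<exists>r s. r \<le> q \<and> s \<le> r * (n - 1) \<and> p = r * m 1 + s * d)"

lemma S_iff: "(\<exists>t. keys t \<subseteq> W \<and> wt a t = p \<and> mon_degree t = q) \<longleftrightarrow> S p q"
proof
  assume "\<exists>t. keys t \<subseteq> W \<and> wt a t = p \<and> mon_degree t = q"
  then obtain t where t: "keys t \<subseteq> W" "wt a t = p" "mon_degree t = q" by blast
  define t' where "t' = restr (\<lambda>i. i \<noteq> Suc n) t"
  have "t = t' + Poly_Mapping.single (Suc n) (lookup t (Suc n))"
    by (intro poly_mapping_eqI) (auto simp: t'_def lookup_add lookup_restr lookup_single when_def)
  then have tt: "wt a t = wt a t'" "mon_degree t = mon_degree t' + lookup t (Suc n)"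
    using wt_add [of a t' "Poly_Mapping.single (Suc n) (lookup t (Suc n))"]
      mon_degree_add [of t' "Poly_Mapping.single (Suc n) (lookup t (Suc n))"] by (auto simp: a_Suc_n)
  have "keys t' \<subseteq> {1..n}"
    using t(1) unfolding t'_def keys_restr by force
  from wt_form [OF this] obtain s where
    "s \<le> mon_degree t' * (n - 1)" "wt a t' = mon_degree t' * m 1 + s * d" by blast
  then show "S p q"
    unfolding S_def using t tt by (intro exI [of _ "mon_degree t'"] exI [of _ s]) auto
next
  assume "S p q"
  then obtain r s where rs: "r \<le> q" "s \<le> r * (n - 1)" "p = r * m 1 + s * d"
    by (auto simp: S_def)
  obtain t where t: "keys t \<subseteq> {1..n}" "mon_degree t = r" "wt a t = r * m 1 + s * d"
    using ex_monomial [OF rs(2)] by blast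
  then show "\<exists>t. keys t \<subseteq> W \<and> wt a t = p \<and> mon_degree t = q"
    using rs by (intro exI [of _ "t + Poly_Mapping.single (Suc n) (q - r)"])
      (auto simp: keys_plus_nat mon_degree_add wt_add a_Suc_n split: if_splits)
qed

lemma bad_Suc_n: "bad a W {n + 1} p q \<longleftrightarrow> (\<exists>q'. q = Suc q' \<and> S p q')"
proof -
  have "bad a W {n + 1} p q \<longleftrightarrow> (\<exists>q'. q = Suc q' \<and> (\<exists>t. keys t \<subseteq> W \<and> wt a t = p \<and> mon_degree t = q'))"
    using bad_singleton [of "n + 1" W a p q] by (auto simp: a_Suc_n)
  then show ?thesis by (simp only: S_iff)
qed

lemma bad_n: "bad a W {n} p q \<longleftrightarrow> (\<exists>p' q'. p = p' + a n \<and> q = Suc q' \<and> S p' q')"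
proof -
  have "bad a W {n} p q \<longleftrightarrow>
      (\<exists>p' q'. p = p' + a n \<and> q = Suc q' \<and> (\<exists>t. keys t \<subseteq> W \<and> wt a t = p' \<and> mon_degree t = q'))"
    using bad_singleton [of n W a p q] n2 by auto
  then show ?thesis by (simp only: S_iff)
qed

text \<open>Coprimality enters here: the representations (r, s) of one weight differ by multiples of
  (d, -m_1). A positive l trades l d factors for an increase of the index sum by l m_1.\<close>

lemma relation:
  assumes "r * m 1 + s * d = r' * m 1 + s' * d"
  obtains l where "int r - int r' = l * int d" "int s' - int s = l * int (m 1)"
proof -
  have eq: "(int r - int r') * int (m 1) = (int s' - int s) * int d"
    using arg_cong [OF assms, of int] by (simp add: algebra_simps)
  have "coprime (int d) (int (m 1))"
    using coprime_m1_d by (simp add: coprime_iff_gcd_eq_1 gcd.commute)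
  moreover have "int d dvd (int r - int r') * int (m 1)"
    unfolding eq by simp
  ultimately have "int d dvd int r - int r'"
    using coprime_dvd_mult_left_iff by blast
  then obtain l where l: "int r - int r' = l * int d"
    by (metis dvd_def mult.commute)
  then have "int s' - int s = l * int (m 1)"
    using eq d_pos by simp
  with l that show thesis by blast
qed

text \<open>This property of the semigroup makes the coordinate ring Cohen-Macaulay.\<close>

lemma S_cohen_macaulay:
  assumes 1: "S p q" and 2: "S (p + a n) q"
  shows "\<exists>q'. q = Suc q' \<and> S p q'"
proof -
  obtain r s where rs: "r \<le> q" "s \<le> r * (n - 1)" "p = r * m 1 + s * d"
    using 1 by (auto simp: S_def)
  obtain r' s' where rs': "r' \<le> q" "s' \<le> r' * (n - 1)" "p + a n = r' * m 1 + s' * d"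
    using 2 by (auto simp: S_def)
  show ?thesis
  proof (cases "r < q")
    case True
    then have "r \<le> q - 1" by simp
    with rs have "S p (q - 1)"
      unfolding S_def by blast
    with True show ?thesis
      by (intro exI [of _ "q - 1"]) simp
  next
    case False
    then have r: "r = q" using rs by simp
    have "(r + 1) * m 1 + (s + (n - 1)) * d = r' * m 1 + s' * d"
      using rs(3) rs'(3) by (simp add: a_n algebra_simps)
    \<comment> \<open>Since r' <= r < r + 1, the shift l is positive and s' is at least s + (n - 1).
      So the second representation can spare one factor x_n, which leaves a representation of p with
      r' - 1 <= q - 1 factors.\<close>
    then obtain l where l: "int (r + 1) - int r' = l * int d" "int s' - int (s + (n - 1)) = l * int (m 1)"
      by (rule relation)
    have "l * int d > 0"
      using l(1) rs' r by simp
    then have "l \<ge> 1"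
      using d_pos by (simp add: zero_less_mult_iff)
    then have "l * int (m 1) \<ge> 0" by simp
    then have s': "s' \<ge> s + (n - 1)" using l(2) by linarith
    have r'1: "r' \<ge> 1"
    proof (rule ccontr)
      assume "\<not> r' \<ge> 1"
      then have "r' = 0" by simp
      with s' rs'(2) n2 show False by simp
    qed
    then obtain r1 where r1: "r' = Suc r1" by (cases r') auto
    have "p + a n = (r1 * m 1 + (s' - (n - 1)) * d) + a n"
    proof -
      have "s' * d = (s' - (n - 1)) * d + (n - 1) * d"
        using s' by (simp flip: add_mult_distrib)
      then show ?thesis
        using rs'(3) by (simp add: r1 a_n)
    qed
    then have "p = r1 * m 1 + (s' - (n - 1)) * d"
      by simp
    moreover have "s' - (n - 1) \<le> r1 * (n - 1)"
      using rs'(2) by (simp add: r1)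
    moreover have "r1 \<le> q - 1" "q = Suc (q - 1)"
      using rs'(1) r1 by auto
    ultimately have "S p (q - 1)"
      unfolding S_def by blast
    with \<open>q = Suc (q - 1)\<close> show ?thesis
      by blast
  qed
qed

text \<open>The degree of the socle of the Artinian reduction. It is positive, although \<open>c\<close> may be \<open>-1\<close>.\<close>

definition K :: nat where "K = nat (c + int d + 1)"

text \<open>From c (n - 1) = m_1 - 1 - \<tau> >= -(n - 1) it follows that c >= -1, and d >= 1 makes
  the sum positive.\<close>

lemma K: "int K = c + int d + 1" "K \<ge> 1"
proof -
  have "c \<ge> - 1"
  proof (rule ccontr)
    assume "\<not> c \<ge> - 1"
    then have "c * (int n - 1) \<le> (- 2) * (int n - 1)"
      using n2 by (intro mult_right_mono) auto
    then show False
      using m1_eq m1_pos \<tau> n2 by auto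
  qed
  then show "int K = c + int d + 1" "K \<ge> 1"
    using d_pos by (auto simp: K_def)
qed

abbreviation bd :: "nat \<Rightarrow> nat \<Rightarrow> bool" where "bd \<equiv> bad a W {n, n + 1}"

lemma bd_iff: "bd p q \<longleftrightarrow> bad a W {n} p q \<or> bad a W {n + 1} p q"
  unfolding bad_def by blast

text \<open>For q >= 1 the bidegree is that of x_1^(q-1) x_j. A monomial in it with a factor x_n or
  x_(n+1) belongs to a shift with l >= 1, for x_n because j < n, and l = 1 is the least demanding
  case. Conversely the shift with l = 1 has q - d < q factors and so leaves room for
  x_(n+1).\<close>

lemma bd_threshold:
  assumes j: "1 \<le> j" "j \<le> n - 1" and p: "p = q * m 1 + (j - 1) * d"
  shows "bd p q \<longleftrightarrow> int j + int \<tau> \<le> (int q + 1 - int K) * (int n - 1)"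
proof -
  have key: "int j + int \<tau> \<le> (int q + 1 - int K) * (int n - 1) \<longleftrightarrow>
      int (j - 1) + int (m 1) \<le> (int q - int d) * (int n - 1)"
    using m1_eq j(1) by (auto simp: K(1) algebra_simps)
  have step: "int (j - 1) + int (m 1) \<le> (int q - int d) * (int n - 1)"
    if l: "l \<ge> 1" and le: "int (j - 1) + l * int (m 1) \<le> (int q - l * int d) * (int n - 1)" for l
  proof -
    have "int (m 1) \<le> l * int (m 1)" "int d \<le> l * int d"
      using mult_right_mono [OF l, of "int (m 1)"] mult_right_mono [OF l, of "int d"] by auto
    moreover from this have "(int q - l * int d) * (int n - 1) \<le> (int q - int d) * (int n - 1)"
      using n2 by (intro mult_right_mono) auto
    ultimately show ?thesis using le by linarith
  qed
  show ?thesis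
    unfolding key
  proof
    assume *: "int (j - 1) + int (m 1) \<le> (int q - int d) * (int n - 1)"
    have "(int q - int d) * (int n - 1) > 0"
      using * m1_pos by linarith
    then have qd: "q > d"
      using n2 by (auto simp: zero_less_mult_iff)
    then have "int ((j - 1) + m 1) \<le> int ((q - d) * (n - 1))"
      using * n2 by (simp add: of_nat_diff)
    then have "(j - 1) + m 1 \<le> (q - d) * (n - 1)"
      by (simp only: of_nat_le_iff)
    moreover have "p = (q - d) * m 1 + ((j - 1) + m 1) * d"
    proof -
      have "q * m 1 = (q - d) * m 1 + d * m 1"
        using qd by (simp flip: add_mult_distrib)
      then show ?thesis
        unfolding p by (simp add: algebra_simps)
    qed
    ultimately have "S p (q - 1)"
      unfolding S_def using d_pos qd by (intro exI [of _ "q - d"] exI [of _ "(j - 1) + m 1"]) auto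
    then show "bd p q"
      unfolding bd_iff bad_Suc_n using qd by (intro disjI2 exI [of _ "q - 1"]) auto
  next
    assume "bd p q"
    then show "int (j - 1) + int (m 1) \<le> (int q - int d) * (int n - 1)"
      unfolding bd_iff
    proof
      assume "bad a W {n + 1} p q"
      then obtain q' where q': "q = Suc q'" "S p q'"
        unfolding bad_Suc_n by blast
      then obtain r s where rs: "r \<le> q'" "s \<le> r * (n - 1)" "p = r * m 1 + s * d"
        by (auto simp: S_def)
      have "q * m 1 + (j - 1) * d = r * m 1 + s * d"
        using p rs(3) by simp
      then obtain l where l: "int q - int r = l * int d" "int s - int (j - 1) = l * int (m 1)"
        by (rule relation)
      have "l * int d > 0"
        using l(1) rs q' by simp
      then have "l \<ge> 1"
        using d_pos by (simp add: zero_less_mult_iff)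
      moreover have "int s \<le> int r * (int n - 1)"
      proof -
        have "int s \<le> int (r * (n - 1))" using rs(2) by (simp only: of_nat_le_iff)
        also have "\<dots> = int r * (int n - 1)" using n2 by (simp add: of_nat_diff)
        finally show ?thesis .
      qed
      moreover have "int (j - 1) + l * int (m 1) = int s" "int q - l * int d = int r"
        using l by linarith+
      ultimately have "int (j - 1) + l * int (m 1) \<le> (int q - l * int d) * (int n - 1)" and "l \<ge> 1"
        by simp_all
      from step [OF this(2,1)] show ?thesis .
    next
      assume "bad a W {n} p q"
      then obtain p' q' where pq': "p = p' + a n" "q = Suc q'" "S p' q'"
        unfolding bad_n by blast
      then obtain r s where rs: "r \<le> q'" "s \<le> r * (n - 1)" "p' = r * m 1 + s * d"
        by (auto simp: S_def)
      have "q * m 1 + (j - 1) * d = (r + 1) * m 1 + (s + (n - 1)) * d"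
        using p rs(3) pq' by (simp add: a_n algebra_simps)
      then obtain l where l: "int q - int (r + 1) = l * int d" "int (s + (n - 1)) - int (j - 1) = l * int (m 1)"
        by (rule relation)
      have "l * int (m 1) > 0"
        using l(2) j by linarith
      then have "l \<ge> 1"
        using m1_pos by (simp add: zero_less_mult_iff)
      moreover have "int (s + (n - 1)) \<le> int (r + 1) * (int n - 1)"
      proof -
        have "s + (n - 1) \<le> (r + 1) * (n - 1)" using rs(2) by simp
        then have "int (s + (n - 1)) \<le> int ((r + 1) * (n - 1))" by (simp only: of_nat_le_iff)
        also have "\<dots> = int (r + 1) * (int n - 1)"
          using n2 by (simp only: of_nat_mult) (simp add: of_nat_diff)
        finally show ?thesis .
      qed
      then have "int (j - 1) + l * int (m 1) \<le> (int q - l * int d) * (int n - 1)"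
      proof -
        have "int (j - 1) + l * int (m 1) = int (s + (n - 1))" using l(2) by linarith
        moreover have "int q - l * int d = int (r + 1)" using l(1) by linarith
        ultimately show ?thesis using \<open>int (s + (n - 1)) \<le> int (r + 1) * (int n - 1)\<close> by metis
      qed
      ultimately show ?thesis by (rule step)
    qed
  qed
qed

text \<open>If the index sum s were at least n - 1, a factor x_n could be split off and the bidegree
  would be bad. Hence s = j - 1 with j < n.\<close>

lemma not_bd_form:
  assumes t: "keys t \<subseteq> {1..n - 1}" "\<not> bd (wt a t) (mon_degree t)" "mon_degree t \<ge> 1"
  obtains j where "1 \<le> j" "j \<le> n - 1" "wt a t = mon_degree t * m 1 + (j - 1) * d"
proof -
  define q where "q = mon_degree t"
  have "{1..n - 1} \<subseteq> {1..n}" by auto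
  then have "keys t \<subseteq> {1..n}"
    using t(1) by blast
  then obtain s where s: "s \<le> q * (n - 1)" "wt a t = q * m 1 + s * d"
    unfolding q_def using wt_form by blast
  obtain q' where q': "q = Suc q'"
    using t(3) by (cases q) (auto simp: q_def)
  have "s \<le> n - 2"
  proof (rule ccontr)
    assume "\<not> s \<le> n - 2"
    then have sn: "s \<ge> n - 1" by simp
    have "s * d = (s - (n - 1)) * d + (n - 1) * d"
      using sn by (simp flip: add_mult_distrib)
    then have "wt a t = (q' * m 1 + (s - (n - 1)) * d) + a n"
      by (simp add: s(2) q' a_n)
    moreover have "S (q' * m 1 + (s - (n - 1)) * d) q'"
      unfolding S_def using s(1) by (intro exI [of _ q'] exI [of _ "s - (n - 1)"]) (auto simp: q')
    ultimately have "bad a W {n} (wt a t) q"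
      unfolding bad_n using q' by blast
    with t(2) show False
      unfolding bd_iff q_def by blast
  qed
  then show thesis
    using that [of "s + 1"] s(2) n2 by (simp add: q_def)
qed

subsection \<open>The socle of the Artinian reduction\<close>

text \<open>The Artinian reduction is \<open>pset {1..n - 1}\<close> modulo
  \<open>J\<close>.\<close>

definition J :: "'k::field mpoly set" where
  "J = kill {n, n + 1} ` toric a W"

lemma W_minus: "W - {n, n + 1} = {1..n - 1}"
  using n2 by auto

lemma J_eq: "J = {f \<in> pset {1..n - 1}. \<forall>p q. \<not> bd p q \<longrightarrow> fibre_sum a p q f = 0}"
  unfolding J_def kill_toric W_minus ..

text \<open>These are x_1^(K-1) x_j for j = n - \<tau>, ..., n - 1, numbered from 0: the indices
  below n with j + \<tau> > n - 1, which is the threshold in degree \<open>K\<close>.\<close>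

definition socle_mon :: "nat \<Rightarrow> nat \<Rightarrow>\<^sub>0 nat" where
  "socle_mon i = Poly_Mapping.single 1 (K - 1) + Poly_Mapping.single (n - \<tau> + i) 1"

definition socle_weight :: "nat \<Rightarrow> nat" where
  "socle_weight i = K * m 1 + (n - \<tau> + i - 1) * d"

lemma socle_mon:
  assumes "i < \<tau>"
  shows "keys (socle_mon i) \<subseteq> {1..n - 1}" "wt a (socle_mon i) = socle_weight i" "mon_degree (socle_mon i) = K"
proof -
  have *: "1 \<le> n - \<tau> + i" "n - \<tau> + i \<le> n - 1"
    using assms \<tau> by auto
  then show "keys (socle_mon i) \<subseteq> {1..n - 1}"
    using n2 by (auto simp: socle_mon_def keys_plus_nat split: if_splits)
  show "mon_degree (socle_mon i) = K"
    using K(2) by (simp add: socle_mon_def mon_degree_add)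
  have "a (n - \<tau> + i) = m 1 + (n - \<tau> + i - 1) * d"
    using * by (intro a_eq) auto
  moreover have "a 1 = m 1"
    using n2 by (simp add: curve_weight_def)
  ultimately have "wt a (socle_mon i) = (K - 1) * m 1 + m 1 + (n - \<tau> + i - 1) * d"
    by (simp add: socle_mon_def wt_add)
  also have "(K - 1) * m 1 + m 1 = K * m 1"
    using K(2) by (cases K) auto
  finally show "wt a (socle_mon i) = socle_weight i"
    by (simp add: socle_weight_def)
qed

lemma socle_weight_inject: "i < \<tau> \<Longrightarrow> i' < \<tau> \<Longrightarrow> socle_weight i = socle_weight i' \<longleftrightarrow> i = i'"
  using d_pos \<tau> by (auto simp: socle_weight_def)

lemma not_bd_sp: "i < \<tau> \<Longrightarrow> \<not> bd (socle_weight i) K"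
  using bd_threshold [of "n - \<tau> + i" "socle_weight i" K] \<tau> by (auto simp: socle_weight_def)

text \<open>Above degree \<open>K\<close> the bound in \<open>bd_threshold\<close> is at least 2 (n
  - 1), while j and \<tau> are at most n - 1 each.\<close>

lemma bd_above: "keys t \<subseteq> {1..n - 1} \<Longrightarrow> mon_degree t > K \<Longrightarrow> bd (wt a t) (mon_degree t)"
proof (rule ccontr)
  assume t: "keys t \<subseteq> {1..n - 1}" "mon_degree t > K" and nb: "\<not> bd (wt a t) (mon_degree t)"
  obtain j where j: "1 \<le> j" "j \<le> n - 1" "wt a t = mon_degree t * m 1 + (j - 1) * d"
    using not_bd_form [OF t(1) nb] t(2) by auto
  have "2 * (int n - 1) \<le> (int (mon_degree t) + 1 - int K) * (int n - 1)"
    using t(2) n2 by (intro mult_right_mono) auto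
  moreover have "int j + int \<tau> \<le> 2 * (int n - 1)"
    using j \<tau> by auto
  ultimately show False
    using nb bd_threshold [OF j] by linarith
qed

text \<open>Up to degree \<open>K\<close> the bound in \<open>bd_threshold\<close> is at most n - 1,
  less than (n - 1) + \<tau>. For q >= 1 this bidegree is that of x_1^(q-1) x_(n-1); it is the
  target to which classes of lower degree are multiplied to see that they are not in the
  socle.\<close>

lemma not_bd_last:
  assumes "q \<le> K"
  shows "\<not> bd (q * m 1 + (n - 1 - 1) * d) q"
proof
  assume "bd (q * m 1 + (n - 1 - 1) * d) q"
  then have "int (n - 1) + int \<tau> \<le> (int q + 1 - int K) * (int n - 1)"
    by (subst (asm) bd_threshold [OF _ _ refl]) (use n2 in auto)
  also have "\<dots> \<le> 1 * (int n - 1)"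
    using assms n2 by (intro mult_right_mono) auto
  finally show False using \<tau> n2 by auto
qed

lemma socle_monomial:
  assumes "i < \<tau>" "v \<in> {1..n - 1}"
  shows "var v * Poly_Mapping.single (socle_mon i) 1 \<in> J" (is "?f \<in> J")
proof -
  define t where "t = Poly_Mapping.single v 1 + socle_mon i"
  have keys: "keys t \<subseteq> {1..n - 1}"
    using socle_mon(1) [OF assms(1)] assms(2) by (auto simp: t_def keys_plus_nat)
  have "mon_degree t > K"
    using socle_mon(3) [OF assms(1)] by (simp add: t_def mon_degree_add)
  then have "bd (wt a t) (mon_degree t)"
    using bd_above keys by blast
  moreover have "?f = Poly_Mapping.single t 1"
    by (simp add: var_def mult_single t_def)
  ultimately show ?thesis
    using keys by (auto simp: J_eq fibre_sum_single simp del: One_nat_def intro: pset_single)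
qed

lemma fibre_sum_combination:
  assumes "i < \<tau>"
  shows "fibre_sum a (socle_weight i) K (\<Sum>i<\<tau>. const (k i) * Poly_Mapping.single (socle_mon i) 1) = k i"
proof -
  have "fibre_sum a (socle_weight i) K (\<Sum>i<\<tau>. const (k i) * Poly_Mapping.single (socle_mon i) 1)
      = (\<Sum>i'<\<tau>. if i' = i then k i' else 0)"
    unfolding fibre_sum_sum using assms
    by (intro sum.cong refl) (simp add: fibre_sum_mult_const fibre_sum_single socle_mon socle_weight_inject)
  also have "\<dots> = k i"
    using assms by simp
  finally show ?thesis .
qed

lemma socle_independent:
  assumes "(\<Sum>i<\<tau>. const (k i) * Poly_Mapping.single (socle_mon i) 1) \<in> J" "i < \<tau>"
  shows "k i = 0"
  using assms fibre_sum_combination [OF assms(2), of k] not_bd_sp by (auto simp: J_eq)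

text \<open>The combination agrees with \<open>f\<close> in the socle bidegrees. Any other surviving
  bidegree of a monomial of \<open>f\<close> has degree q < K, and a suitable variable v carries it
  to the surviving bidegree of \<open>not_bd_last\<close> in degree q + 1. There the equation for v
  f forces the sum of \<open>f\<close> to vanish.\<close>

lemma socle_spanning:
  fixes f :: "'k::field mpoly"
  assumes f: "f \<in> pset {1..n - 1}" "\<And>v. v \<in> {1..n - 1} \<Longrightarrow> var v * f \<in> J"
  shows "f - (\<Sum>i<\<tau>. const (fibre_sum a (socle_weight i) K f) * Poly_Mapping.single (socle_mon i) 1) \<in> J"
proof -
  define g where "g = (\<Sum>i<\<tau>. const (fibre_sum a (socle_weight i) K f) * Poly_Mapping.single (socle_mon i) 1)"
  have "g \<in> pset {1..n - 1}"
    unfolding g_def using socle_mon(1) by (intro pset_sum pset_mult) (auto intro: pset_single)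
  then have "f - g \<in> pset {1..n - 1}"
    using f(1) by blast
  moreover have "fibre_sum a p q (f - g) = 0" if nb: "\<not> bd p q" for p q
  proof (cases "q = K \<and> (\<exists>i<\<tau>. p = socle_weight i)")
    case True
    then show ?thesis
      using fibre_sum_combination [of _ "\<lambda>i. fibre_sum a (socle_weight i) K f"] by (auto simp: fibre_sum_diff g_def)
  next
    case other: False
    have "fibre_sum a p q (const k * Poly_Mapping.single (socle_mon i) 1) = 0" if "i < \<tau>" for i and k :: 'k
      using that other socle_mon [OF that] by (auto simp: fibre_sum_mult_const fibre_sum_single)
    then have "fibre_sum a p q g = 0"
      by (simp add: g_def fibre_sum_sum)
    moreover have "fibre_sum a p q f = 0"
    proof (rule ccontr)
      assume "fibre_sum a p q f \<noteq> 0"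
      then obtain t where t: "t \<in> keys f" "wt a t = p" "mon_degree t = q"
        using fibre_sum_nonzero by blast
      have kt: "keys t \<subseteq> {1..n - 1}"
        using t(1) f(1) by (auto simp: pset_def)
      have kill: False if v: "v \<in> {1..n - 1}" and "\<not> bd (p + a v) (Suc q)" for v
      proof -
        have "fibre_sum a (p + a v) (Suc q) (var v * f) = 0"
          using f(2) [OF v] that(2) by (auto simp: J_eq)
        then show False
          using \<open>fibre_sum a p q f \<noteq> 0\<close> by (simp add: fibre_sum_mult_var)
      qed
      show False
      proof (cases "q = 0")
        case True
        then have "t = 0" using t(3) by (simp add: mon_degree_eq_0)
        then have p0: "p = 0" using t(2) by simp
        \<comment> \<open>Degree 0 has no representative x_1^(q-1) x_j, so the constant term is
          treated apart, with the factor x_(n-1).\<close>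
        have "p + a (n - 1) = Suc q * m 1 + (n - 1 - 1) * d"
          using n2 True p0 by (simp add: a_eq)
        then have "\<not> bd (p + a (n - 1)) (Suc q)"
          using not_bd_last [of "Suc q"] K(2) True by simp
        moreover have "n - 1 \<in> {1..n - 1}"
          using n2 by simp
        ultimately show False using kill by blast
      next
        case False
        then obtain j where j: "1 \<le> j" "j \<le> n - 1" "p = q * m 1 + (j - 1) * d"
          using not_bd_form [OF kt] nb t by auto
        have "q \<le> K"
          using bd_above [OF kt] nb t by (meson not_le)
        show False
        proof (cases "q = K")
          case True
          have "\<not> int j + int \<tau> \<le> int n - 1"
            using bd_threshold [OF j] nb True by simp
          then have "j \<ge> n - \<tau>" using \<tau> by auto
          then have "p = socle_weight (j - (n - \<tau>))" "j - (n - \<tau>) < \<tau>"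
            using j True \<tau> by (auto simp: socle_weight_def)
          with other True show False by blast
        next
          case qK: False
          \<comment> \<open>The factor x_(n-j) raises the index sum from j - 1 to n - 2, the value
            in \<open>not_bd_last\<close>.\<close>
          have nj: "n - j \<in> {1..n - 1}" using j by auto
          have "j - 1 + (n - j - 1) = n - 1 - 1"
            using nj j by auto
          then have "(j - 1) * d + (n - j - 1) * d = (n - 1 - 1) * d"
            by (simp only: add_mult_distrib [symmetric])
          then have "p + a (n - j) = Suc q * m 1 + (n - 1 - 1) * d"
            using nj j by (simp add: a_eq)
          then have "\<not> bd (p + a (n - j)) (Suc q)"
            using not_bd_last [of "Suc q"] \<open>q \<le> K\<close> qK by simp
          then show False using kill nj by blast
        qed
      qed
    qed
    ultimately show ?thesis by (simp add: fibre_sum_diff)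
  qed
  ultimately show ?thesis
    unfolding g_def by (auto simp: J_eq)
qed

section \<open>The regular sequence and the ranks of a resolution\<close>

lemma regular_Suc_n:
  assumes "f \<in> pset W" "var (n + 1) * f \<in> toric a W"
  shows "f \<in> toric a W"
proof -
  have "fibre_sum a p q f = 0" for p q
    using assms(2) fibre_sum_mult_var [of a p "n + 1" q f] by (auto simp: toric_def a_Suc_n)
  with assms(1) show ?thesis by (simp add: toric_def)
qed

text \<open>If a bidegree (p, q) occurs in f and survives, then by \<open>S_cohen_macaulay\<close>
  its shift by x_n contains no monomial with a factor x_(n+1), so it survives too. Hence the
  equation of x_n f there is the equation of f at (p, q).\<close>

lemma regular_n:
  assumes f: "f \<in> pset (W - {n + 1})" "var n * f \<in> kill {n + 1} ` toric a W"
  shows "f \<in> kill {n + 1} ` toric a W"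
proof -
  have "fibre_sum a p q f = 0" if nb: "\<not> bad a W {n + 1} p q" for p q
  proof (rule ccontr)
    assume nz: "fibre_sum a p q f \<noteq> 0"
    then obtain t where t: "t \<in> keys f" "wt a t = p" "mon_degree t = q"
      using fibre_sum_nonzero by blast
    then have "S p q"
      using f(1) unfolding S_iff [symmetric] pset_def by blast
    then have "\<not> S (p + a n) q"
      using S_cohen_macaulay nb unfolding bad_Suc_n by blast
    then have "\<not> bad a W {n + 1} (p + a n) (Suc q)"
      unfolding bad_Suc_n by blast
    then have "fibre_sum a (p + a n) (Suc q) (var n * f) = 0"
      using f(2) unfolding kill_toric by blast
    with nz show False by (simp add: fibre_sum_mult_var)
  qed
  with f(1) show ?thesis
    unfolding kill_toric by blast
qed

lemma vanishing_ideal_eq: "vanishing_ideal n m = toric a W"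
proof (rule vanishing_ideal_eq_toric)
  have "m i \<le> m n" if i: "i \<in> {1..n}" for i
  proof -
    have "m i = m 1 + (i - 1) * d" "m n = m 1 + (n - 1) * d"
      using m_eq [rule_format, OF i] m_eq [rule_format, of n] n2 by simp_all
    then show ?thesis
      using i by (simp add: diff_le_mono)
  qed
  note le = this
  show "m i \<le> m n" if "i \<in> {1..n}" for i
    using that by (rule le)
  show "m n > 0"
    using le [of 1] m1_pos n2 by simp
qed

lemma basis_mod_socle:
  defines "Z \<equiv> {w \<in> fm {1..n - 1} 1. w 0 \<in> (J :: 'k::field mpoly set)}"
  shows "basis_mod \<tau> (\<lambda>i k. if k = 0 then Poly_Mapping.single (socle_mon i) 1 else 0) (soc {1..n - 1} 1 Z) Z"
    (is "basis_mod _ ?h _ _")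
proof -
  have h: "?h i \<in> fm {1..n - 1} 1" if "i < \<tau>" for i
    using socle_mon(1) [OF that] by (auto simp: fm_def simp del: One_nat_def intro: pset_single)
  have sum: "(\<Sum>i<\<tau>. smul (const (k i)) (?h i)) 0 = (\<Sum>i<\<tau>. const (k i) * Poly_Mapping.single (socle_mon i) 1)" for k
    by (simp add: sum_fun_apply smul_def)
  have sum_fm: "(\<Sum>i<\<tau>. smul (const (k i)) (?h i)) \<in> fm {1..n - 1} 1" for k
    using h by (intro fm_sum fm_smul) auto
  show ?thesis
    unfolding basis_mod_def
  proof (intro conjI allI impI ballI)
    fix i assume i: "i < \<tau>"
    have "smul (var v) (?h i) \<in> Z" if v: "v \<in> {1..n - 1}" for v
    proof -
      have "smul (var v) (?h i) \<in> fm {1..n - 1} 1"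
        using h [OF i] pset_var [OF v] by (intro fm_smul)
      moreover have "smul (var v) (?h i) 0 \<in> J"
        using socle_monomial [OF i v] by (simp add: smul_def)
      ultimately show ?thesis
        unfolding Z_def by blast
    qed
    then show "?h i \<in> soc {1..n - 1} 1 Z"
      using h [OF i] unfolding soc_def by blast
  next
    fix f assume "f \<in> soc {1..n - 1} 1 Z"
    then have f: "f \<in> fm {1..n - 1} 1" "\<And>v. v \<in> {1..n - 1} \<Longrightarrow> smul (var v) f \<in> Z"
      by (auto simp: soc_def)
    have "f 0 \<in> pset {1..n - 1}"
      using f(1) unfolding fm_def by blast
    moreover have "var v * f 0 \<in> J" if "v \<in> {1..n - 1}" for v
      using f(2) [OF that] by (simp add: Z_def smul_def)
    ultimately have "f 0 - (\<Sum>i<\<tau>. const (fibre_sum a (socle_weight i) K (f 0)) * Poly_Mapping.single (socle_mon i) 1) \<in> J"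
      by (rule socle_spanning)
    moreover define k where "k i = fibre_sum a (socle_weight i) K (f 0)" for i
    ultimately have "(f - (\<Sum>i<\<tau>. smul (const (k i)) (?h i))) 0 \<in> J"
      using sum [of k] by simp
    then have "f - (\<Sum>i<\<tau>. smul (const (k i)) (?h i)) \<in> Z"
      unfolding Z_def using fm_diff [OF f(1) sum_fm] by blast
    then show "\<exists>k. f - (\<Sum>i<\<tau>. smul (const (k i)) (?h i)) \<in> Z"
      by (intro exI [of _ k])
  next
    fix k i assume "(\<Sum>i<\<tau>. smul (const (k i)) (?h i)) \<in> Z" and i: "i < \<tau>"
    then have "(\<Sum>i<\<tau>. smul (const (k i)) (?h i)) 0 \<in> J"
      unfolding Z_def by blast
    then show "k i = 0"
      unfolding sum using i by (rule socle_independent)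
  qed
qed

text \<open>The given resolution is reduced by x_(n+1) and then by x_n, which is regular on the
  quotient. The ideal becomes \<open>J\<close>, and n - 1 variables remain for
  \<open>last_rank\<close>; the two reductions do not change the ranks.\<close>

theorem resolution_ranks:
  assumes "minimal_graded_free_resolution (n + 1) (vanishing_ideal n m :: 'k::field mpoly set) e \<phi>"
  shows "length (e (n - 1)) = \<tau> \<and> (\<forall>i > n - 1. length (e i) = 0)"
proof -
  define b where "b i = length (e i)" for i
  define A where "A i = mat_fun (\<phi> (Suc i))" for i
  note res = resolution_acyclic_complex [OF assms, folded b_def [abs_def] A_def [abs_def]]
  have ac0: "acyclic_complex W b A" and b0: "b 0 = 1" and min: "\<And>i k j. lookup (A i k j) 0 = 0"
    using res by (auto simp: b_def [abs_def] A_def [abs_def])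
  define I where "I = (toric a W :: 'k mpoly set)"
  have im0: "im W b A 0 = {w \<in> fm W 1. w 0 \<in> I}"
    using res(2) unfolding vanishing_ideal_eq I_def .
  have "w \<in> im W b A 0" if w: "w \<in> fm W (b 0)" "smul (var (n + 1)) w \<in> im W b A 0" for w
  proof -
    have "w 0 \<in> pset W" "var (n + 1) * w 0 \<in> I"
      using w unfolding im0 smul_def fm_def by blast+
    then show ?thesis
      using w(1) regular_Suc_n unfolding im0 b0 I_def by blast
  qed
  then have ac1: "acyclic_complex (W - {n + 1}) b (\<lambda>i. killm {n + 1} (A i))"
    by (intro acyclic_complex_kill [OF ac0]) auto
  define A1 where "A1 i = killm {n + 1} (A i)" for i
  have I: "I \<subseteq> pset W"
    by (auto simp: I_def toric_def)
  have im1: "im (W - {n + 1}) b A1 0 = {w \<in> fm (W - {n + 1}) 1. w 0 \<in> kill {n + 1} ` I}"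
    using im_kill [OF ac0, of "{n + 1}" 0] unfolding im0 killv_image [OF I] A1_def [abs_def] .
  have "w \<in> im (W - {n + 1}) b A1 0"
    if w: "w \<in> fm (W - {n + 1}) (b 0)" "smul (var n) w \<in> im (W - {n + 1}) b A1 0" for w
  proof -
    have "w 0 \<in> pset (W - {n + 1})" "var n * w 0 \<in> kill {n + 1} ` I"
      using w unfolding im1 smul_def fm_def by blast+
    then show ?thesis
      using w(1) regular_n unfolding im1 b0 I_def by blast
  qed
  then have "acyclic_complex (W - {n + 1} - {n}) b (\<lambda>i. killm {n} (A1 i))"
    using n2 by (intro acyclic_complex_kill [OF ac1 [folded A1_def]]) auto
  moreover define A2 where "A2 i = killm {n} (A1 i)" for i
  moreover have U: "W - {n + 1} - {n} = {1..n - 1}"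
    using n2 by auto
  ultimately have ac2: "acyclic_complex {1..n - 1} b A2"
    by (simp only: A2_def [abs_def])
  have "kill {n + 1} ` I \<subseteq> pset (W - {n + 1})"
    using I kill_pset by blast
  then have "im (W - {n + 1} - {n}) b A2 0
      = {w \<in> fm (W - {n + 1} - {n}) 1. w 0 \<in> kill {n} ` kill {n + 1} ` I}"
    using im_kill [OF ac1 [folded A1_def], of "{n}" 0] killv_image [of "kill {n + 1} ` I" "W - {n + 1}" "{n}"]
    unfolding im1 A2_def [abs_def] by simp
  moreover have "kill {n} ` kill {n + 1} ` I = J"
    unfolding J_def I_def image_image kill_kill by (simp add: insert_commute)
  ultimately have im2: "im {1..n - 1} b A2 0 = {w \<in> fm {1..n - 1} 1. w 0 \<in> J}"
    unfolding U by simp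
  have "b (card {1..n - 1}) = \<tau> \<and> (\<forall>i > card {1..n - 1}. b i = 0)"
  proof (rule last_rank [OF _ ac2])
    show "lookup (A2 i k j) 0 = 0" for i k j
      by (simp add: A2_def A1_def killm_def kill_def lookup_restr min)
    show "basis_mod \<tau> (\<lambda>i k. if k = 0 then Poly_Mapping.single (socle_mon i) 1 else 0)
        (soc {1..n - 1} (b 0) (im {1..n - 1} b A2 0)) (im {1..n - 1} b A2 0)"
      unfolding im2 b0 by (rule basis_mod_socle)
  qed simp
  then show ?thesis
    by (simp add: b_def)
qed

text \<open>The equation for (p, q) involves only monomials of degree q, so homogeneous components
  stay in the ideal. In bidegree (0, 0) the only monomial is 1, so elements of the ideal have no
  constant term.\<close>

theorem ex_resolution:
  "\<exists>e \<phi>. minimal_graded_free_resolution (n + 1) (vanishing_ideal n m :: 'k::field mpoly set) e \<phi>"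
  unfolding vanishing_ideal_eq
proof (rule ex_minimal_graded_free_resolution)
  fix f g h :: "'k mpoly" and D :: int
  show "toric a W \<subseteq> polys (n + 1)"
    unfolding toric_def polys_eq_pset by blast
  show "0 \<in> toric a W"
    by (simp add: toric_def)
  assume f: "f \<in> toric a W"
  show "lookup f 0 = 0"
  proof (rule ccontr)
    assume "lookup f 0 \<noteq> 0"
    have "restr (\<lambda>t. wt a t = 0 \<and> mon_degree t = 0) f = Poly_Mapping.single 0 (lookup f 0)"
      by (intro poly_mapping_eqI) (auto simp: lookup_restr lookup_single when_def mon_degree_eq_0)
    then have "fibre_sum a 0 0 f = lookup f 0"
      by (simp add: fibre_sum_def)
    with \<open>lookup f 0 \<noteq> 0\<close> f show False
      by (simp add: toric_def)
  qed
  have "fibre_sum a p q (restr (\<lambda>t. int (mon_degree t) = D) f) = (if int q = D then fibre_sum a p q f else 0)" for p q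
  proof (cases "int q = D")
    case True
    have "restr (\<lambda>t. wt a t = p \<and> mon_degree t = q) (restr (\<lambda>t. int (mon_degree t) = D) f)
        = restr (\<lambda>t. wt a t = p \<and> mon_degree t = q) f"
      using True by (intro poly_mapping_eqI) (auto simp: lookup_restr)
    with True show ?thesis by (simp add: fibre_sum_def)
  next
    case False
    then have "fibre_sum a p q (restr (\<lambda>t. int (mon_degree t) = D) f) = 0"
      by (intro fibre_sum_eq_0) (auto simp: keys_restr)
    with False show ?thesis by simp
  qed
  then show "restr (\<lambda>t. int (mon_degree t) = D) f \<in> toric a W"
    using f by (simp add: toric_def pset_restr)
  show "g \<in> toric a W \<Longrightarrow> f + g \<in> toric a W"
    using f by (auto simp: toric_def fibre_sum_add)
  show "h \<in> polys (n + 1) \<Longrightarrow> h * f \<in> toric a W"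
    using toric_mult f unfolding polys_eq_pset by blast
qed

end

theorem theorem2p13:
  fixes n d \<tau> :: nat and m :: "nat \<Rightarrow> nat" and c :: int
  assumes "infinite (UNIV :: 'k::field set)"
    and "n \<ge> 2"
    and "m 1 > 0" and "d > 0"
    and "\<forall>i \<in> {1..n}. m i = m 1 + (i - 1) * d"
    and "gcd (m 1) d = 1"
    and "\<tau> \<in> {1..n - 1}"
    and "int (m 1) - 1 = c * (int n - 1) + int \<tau>"
  shows "cohen_macaulay_type (n + 1) (vanishing_ideal n m :: 'k mpoly set) = \<tau>"
proof -
  interpret arithmetic_curve n d \<tau> m c
    using assms by unfold_locales
  let ?I = "vanishing_ideal n m :: 'k mpoly set"
  obtain e \<phi> where res: "minimal_graded_free_resolution (n + 1) ?I e \<phi>"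
    using ex_resolution by blast
  \<comment> \<open>The claim for an arbitrary minimal resolution is what makes the value of
    \<open>THE\<close> unique.\<close>
  have ranks: "length (e' (n - 1)) = \<tau> \<and> (\<forall>i > n - 1. e' i = [])"
    if "minimal_graded_free_resolution (n + 1) ?I e' \<phi>'" for e' \<phi>'
    using resolution_ranks [OF that] by simp
  have \<tau>_pos: "\<tau> > 0"
    using assms(7) by simp
  show ?thesis
    unfolding cohen_macaulay_type_def
  proof (rule the_equality)
    have "e (n - 1) \<noteq> []"
      using ranks [OF res] \<tau>_pos by auto
    then show "\<exists>e \<phi> p. minimal_graded_free_resolution (n + 1) ?I e \<phi> \<and>
        e p \<noteq> [] \<and> (\<forall>i > p. e i = []) \<and> \<tau> = length (e p)"
      using res ranks [OF res] by metis
  next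
    fix t
    assume "\<exists>e \<phi> p. minimal_graded_free_resolution (n + 1) ?I e \<phi> \<and>
        e p \<noteq> [] \<and> (\<forall>i > p. e i = []) \<and> t = length (e p)"
    then obtain e' \<phi>' p where e': "minimal_graded_free_resolution (n + 1) ?I e' \<phi>'"
      "e' p \<noteq> []" "\<forall>i > p. e' i = []" "t = length (e' p)"
      by blast
    \<comment> \<open>The last position is forced: F_(n-1) has rank \<tau> > 0 and all later modules
      vanish.\<close>
    have "p = n - 1"
    proof (rule linorder_cases [of p "n - 1"])
      assume "p < n - 1"
      with e'(3) ranks [OF e'(1)] \<tau>_pos show ?thesis by auto
    next
      assume "n - 1 < p"
      with e'(2) ranks [OF e'(1)] show ?thesis by blast
    qed
    with e'(4) ranks [OF e'(1)] show "t = \<tau>" by simp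
  qed
qed

end
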